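(* If the minimal operator $L_0$ generated by $l(u)=u'(t)+A(t)u(t)$ is formally normal in $L^2_\alpha$, then $$A^{*}(t)A(t)-A(t)A^{*}(t)=\left(2A_r(t)-\frac{\alpha'(t)}{\alpha(t)}I\right)'\quad\text{for a.e. } t\in(0,1),$$ where $A_r(t)=\operatorname{Re}A(t)=\frac12\overline{(A(t)+A^*(t))}$, $t\in(0,1)$, and $I$ is the identity operator in $H$.
   Context: $H$ is a separable (complex) Hilbert space. $\alpha:[0,1]\to[0,\infty)$ is of class $C^{2}$ on $[0,1]$ and its zero set $\{t\in[0,1]:\alpha(t)=0\}$ has Lebesgue measure $0$. $L^2_\alpha=L^2_\alpha(H,(0,1))$ is the weighted Hilbert space of $H$-valued functions on $(0,1)$ with inner product $\langle u,v\rangle_{L^2_\alpha}=\int_0^1\langle u(t),v(t)\rangle_H\,\alpha(t)\,dt$. Standing assumptions on $A(\cdot)$: (1) for each $t\in[0,1]$, $A(t):D(A(t))\subset H\to H$ is a densely defined closed operator; (2) $D(A(t))=D(A)$ does not depend on $t\in[0,1]$ and is dense in $H$; (3) for every $f\in D(A)$ the vector function $t\mapsto A(t)f$ is strongly continuously differentiable in $H$ on $[0,1]$; (4) $A_r(t)\ge \frac{\alpha'(t)}{2\alpha(t)}I$ for a.e. $t\in(0,1)$, where $A_r(t)=\frac12\overline{(A(t)+A^*(t))}$. The differential-operator expression is $l(u)=u'(t)+A(t)u(t)$. Let $D_0'$ be the set of all $u(t)=\sum_{k=1}^n\varphi_k(t)f_k$ with $n\in\mathbb N$, $\varphi_k\in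 C_0^\infty(0,1)$, $f_k\in D(A)$, and let $L_0'u=l(u)$ for $u\in D_0'$. The operator $L_0'$ is closable in $L^2_\alpha$, and its closure $L_0$ is called the minimal operator generated by $l(\cdot)$. A densely defined closed operator $N$ in a Hilbert space is formally normal if $D(N)\subset D(N^* )$ and $\|Nu\|=\|N^*u\|$ for all $u\in D(N)$. The derivative of an operator function of $t$ is the strong derivative, i.e. the derivative of its action on fixed vectors.
   Formalization: Equality with equal domains fails for α=1, A(t) constant unbounded self-adjoint ≥0. Proved: both sides agree on vectors where both exist (strong derivative); on all of the domain of A*A−AA* the derivative exists with that value when tested against D(A). *)

theory Defs
  imports "HOL-Analysis.Analysis" "HOL-Library.Function_Algebras"
begin

section \<open>Complex Hilbert spaces\<close>

class scaleC =
  fixes scaleC :: "complex \<Rightarrow> 'a \<Rightarrow> 'a" (infixr "*\<^sub>C" 75)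

instantiation "fun" :: (type, scaleC) scaleC
begin
definition scaleC_fun_def: "c *\<^sub>C u = (\<lambda>x. c *\<^sub>C u x)"
instance ..
end

class chilbert_space = banach + scaleC +
  fixes cinner :: "'a \<Rightarrow> 'a \<Rightarrow> complex"
  assumes scaleC_add_right: "c *\<^sub>C (x + y) = c *\<^sub>C x + c *\<^sub>C y"
    and scaleC_add_left: "(c + d) *\<^sub>C x = c *\<^sub>C x + d *\<^sub>C x"
    and scaleC_scaleC: "c *\<^sub>C d *\<^sub>C x = (c * d) *\<^sub>C x"
    and scaleR_scaleC: "r *\<^sub>R x = complex_of_real r *\<^sub>C x"
    and cinner_add_left: "cinner (x + y) z = cinner x z + cinner y z"
    and cinner_scaleC_left: "cinner (c *\<^sub>C x) y = c * cinner x y"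
    and cinner_commute: "cinner x y = cnj (cinner y x)"
    and cinner_self: "cinner x x = complex_of_real ((norm x)\<^sup>2)"


section \<open>Unbounded operators as graphs\<close>

text \<open>
  A (possibly unbounded) operator is its graph, a set of pairs \<open>(u, S u)\<close>; its domain is
  \<open>Domain S\<close>. The Hilbert space is given by a carrier \<open>V\<close> and an inner product \<open>ip\<close>. The
  form \<open>ip\<close> need only be semidefinite on \<open>V\<close>, so that \<open>V\<close> may consist of representatives:
  elements at distance zero stand for the same vector. For a Hilbert space that is a type, take
  \<open>V = UNIV\<close> and \<open>ip = cinner\<close>.
\<close>

definition ip_norm :: "('v \<Rightarrow> 'v \<Rightarrow> complex) \<Rightarrow> 'v \<Rightarrow> real" where
  "ip_norm ip u = sqrt (Re (ip u u))"

definition linear_operator ::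
    "'v::{ab_group_add,scaleC} set \<Rightarrow> ('v \<Rightarrow> 'v \<Rightarrow> complex) \<Rightarrow> ('v \<times> 'v) set \<Rightarrow> bool" where
  "linear_operator V ip S \<longleftrightarrow>
     S \<subseteq> V \<times> V \<and> (0, 0) \<in> S \<and>
     (\<forall>u v u' v'. (u, v) \<in> S \<longrightarrow> (u', v') \<in> S \<longrightarrow> (u + u', v + v') \<in> S) \<and>
     (\<forall>c u v. (u, v) \<in> S \<longrightarrow> (c *\<^sub>C u, c *\<^sub>C v) \<in> S) \<and>
     (\<forall>u v w. (u, v) \<in> S \<longrightarrow> (u, w) \<in> S \<longrightarrow> ip_norm ip (v - w) = 0)"

definition densely_defined ::
    "'v::ab_group_add set \<Rightarrow> ('v \<Rightarrow> 'v \<Rightarrow> complex) \<Rightarrow> ('v \<times> 'v) set \<Rightarrow> bool" where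
  "densely_defined V ip S \<longleftrightarrow> (\<forall>v\<in>V. \<forall>e>0. \<exists>u\<in>Domain S. ip_norm ip (u - v) < e)"

definition op_closure ::
    "'v::ab_group_add set \<Rightarrow> ('v \<Rightarrow> 'v \<Rightarrow> complex) \<Rightarrow> ('v \<times> 'v) set \<Rightarrow> ('v \<times> 'v) set" where
  "op_closure V ip S =
     {(u, v) \<in> V \<times> V.
        \<forall>e>0. \<exists>(u', v')\<in>S. ip_norm ip (u' - u) < e \<and> ip_norm ip (v' - v) < e}"

definition closed_operator ::
    "'v::{ab_group_add,scaleC} set \<Rightarrow> ('v \<Rightarrow> 'v \<Rightarrow> complex) \<Rightarrow> ('v \<times> 'v) set \<Rightarrow> bool" where
  "closed_operator V ip S \<longleftrightarrow> linear_operator V ip S \<and> op_closure V ip S = S"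

definition op_adjoint ::
    "'v set \<Rightarrow> ('v \<Rightarrow> 'v \<Rightarrow> complex) \<Rightarrow> ('v \<times> 'v) set \<Rightarrow> ('v \<times> 'v) set" where
  "op_adjoint V ip S = {(v, w) \<in> V \<times> V. \<forall>(u, z)\<in>S. ip z v = ip u w}"

definition formally_normal ::
    "'v::{ab_group_add,scaleC} set \<Rightarrow> ('v \<Rightarrow> 'v \<Rightarrow> complex) \<Rightarrow> ('v \<times> 'v) set \<Rightarrow> bool" where
  "formally_normal V ip N \<longleftrightarrow>
     closed_operator V ip N \<and> densely_defined V ip N \<and>
     Domain N \<subseteq> Domain (op_adjoint V ip N) \<and>
     (\<forall>u v w. (u, v) \<in> N \<longrightarrow> (u, w) \<in> op_adjoint V ip N \<longrightarrow> ip_norm ip v = ip_norm ip w)"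

text \<open>Algebraic operations, with the natural (maximal) domains.\<close>

definition op_add :: "('v::ab_group_add \<times> 'v) set \<Rightarrow> ('v \<times> 'v) set \<Rightarrow> ('v \<times> 'v) set" where
  "op_add S T = {(f, g + h) | f g h. (f, g) \<in> S \<and> (f, h) \<in> T}"

definition op_diff :: "('v::ab_group_add \<times> 'v) set \<Rightarrow> ('v \<times> 'v) set \<Rightarrow> ('v \<times> 'v) set" where
  "op_diff S T = {(f, g - h) | f g h. (f, g) \<in> S \<and> (f, h) \<in> T}"

definition op_scale :: "complex \<Rightarrow> ('v::scaleC \<times> 'v) set \<Rightarrow> ('v \<times> 'v) set" where
  "op_scale c S = {(f, c *\<^sub>C g) | f g. (f, g) \<in> S}"

definition op_mult :: "('v \<times> 'v) set \<Rightarrow> ('v \<times> 'v) set \<Rightarrow> ('v \<times> 'v) set" where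
  "op_mult S T = T O S"


section \<open>Operators in \<open>H\<close>\<close>

abbreviation adj :: "('h::chilbert_space \<times> 'h) set \<Rightarrow> ('h \<times> 'h) set" where
  "adj S \<equiv> op_adjoint UNIV cinner S"

definition op_Re :: "('h::chilbert_space \<times> 'h) set \<Rightarrow> ('h \<times> 'h) set" where
  "op_Re S = op_scale (1/2) (op_closure UNIV cinner (op_add S (adj S)))"

text \<open>The inequality \<open>S \<ge> c I\<close> in the sense of quadratic forms.\<close>

definition op_bounded_below :: "('h::chilbert_space \<times> 'h) set \<Rightarrow> real \<Rightarrow> bool" where
  "op_bounded_below S c \<longleftrightarrow>
     (\<forall>(f, g)\<in>S. Im (cinner g f) = 0 \<and> c * (norm f)\<^sup>2 \<le> Re (cinner g f))"

text \<open>
  The strong derivative at \<open>t\<close> of an operator function \<open>T\<close>: it acts on those fixed vectors \<open>f\<close>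
  that lie in the domain of \<open>T s\<close> for all \<open>s\<close> near \<open>t\<close> and for which \<open>s \<mapsto> T s f\<close> is
  differentiable at \<open>t\<close> in norm.
\<close>

definition strong_derivative ::
    "(real \<Rightarrow> ('h::chilbert_space \<times> 'h) set) \<Rightarrow> real \<Rightarrow> ('h \<times> 'h) set" where
  "strong_derivative T t =
     {(f, d). \<exists>x. (\<forall>\<^sub>F s in nhds t. (f, x s) \<in> T s) \<and> (x has_vector_derivative d) (at t)}"

text \<open>The same, with differentiability at \<open>t\<close> tested against the vectors of \<open>E\<close> only.\<close>

definition weak_derivative ::
    "'h set \<Rightarrow> (real \<Rightarrow> ('h::chilbert_space \<times> 'h) set) \<Rightarrow> real \<Rightarrow> ('h \<times> 'h) set" where
  "weak_derivative E T t =
     {(f, d). \<exists>x. (\<forall>\<^sub>F s in nhds t. (f, x s) \<in> T s) \<and>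
                  (\<forall>e\<in>E. ((\<lambda>s. cinner (x s) e) has_vector_derivative cinner d e) (at t))}"


section \<open>The weighted space and the minimal operator\<close>

text \<open>Square integrable functions, not classes of them; see the remark on \<open>V\<close> and \<open>ip\<close> above.\<close>

definition L2w :: "(real \<Rightarrow> real) \<Rightarrow> (real \<Rightarrow> 'h::chilbert_space) set" where
  "L2w \<alpha> = {u. u \<in> borel_measurable (lebesgue_on {0<..<1}) \<and>
               integrable (lebesgue_on {0<..<1}) (\<lambda>t. \<alpha> t * (norm (u t))\<^sup>2)}"

definition L2w_inner ::
    "(real \<Rightarrow> real) \<Rightarrow> (real \<Rightarrow> 'h::chilbert_space) \<Rightarrow> (real \<Rightarrow> 'h) \<Rightarrow> complex" where
  "L2w_inner \<alpha> u v =
     (LINT t|lebesgue_on {0<..<1}. cinner (u t) (v t) * complex_of_real (\<alpha> t))"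

text \<open>\<open>C\<^sub>0\<^sup>\<infinity>(0,1)\<close>; \<open>F k\<close> is the \<open>k\<close>-th derivative.\<close>

definition test_function :: "(real \<Rightarrow> complex) \<Rightarrow> bool" where
  "test_function \<phi> \<longleftrightarrow>
     (\<exists>F :: nat \<Rightarrow> real \<Rightarrow> complex.
        F 0 = \<phi> \<and> (\<forall>k t. (F k has_vector_derivative F (Suc k) t) (at t))) \<and>
     (\<exists>K. compact K \<and> K \<subseteq> {0<..<1} \<and> (\<forall>t. t \<notin> K \<longrightarrow> \<phi> t = 0))"

definition D0 :: "'h::chilbert_space set \<Rightarrow> (real \<Rightarrow> 'h) set" where
  "D0 D = {u. \<exists>(n::nat) \<phi> f. (\<forall>k<n. test_function (\<phi> k) \<and> f k \<in> D) \<and>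
                           u = (\<lambda>t. \<Sum>k<n. \<phi> k t *\<^sub>C f k)}"

definition pre_minimal_operator ::
    "(real \<Rightarrow> real) \<Rightarrow> 'h::chilbert_space set \<Rightarrow> (real \<Rightarrow> ('h \<times> 'h) set) \<Rightarrow>
      ((real \<Rightarrow> 'h) \<times> (real \<Rightarrow> 'h)) set" where
  "pre_minimal_operator \<alpha> D A =
     {(u, v) \<in> L2w \<alpha> \<times> L2w \<alpha>. u \<in> D0 D \<and>
        (\<forall>t\<in>{0<..<1}. \<exists>w. (u t, w) \<in> A t \<and> v t = vector_derivative u (at t) + w)}"

definition minimal_operator ::
    "(real \<Rightarrow> real) \<Rightarrow> 'h::chilbert_space set \<Rightarrow> (real \<Rightarrow> ('h \<times> 'h) set) \<Rightarrow>
      ((real \<Rightarrow> 'h) \<times> (real \<Rightarrow> 'h)) set" where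
  "minimal_operator \<alpha> D A = op_closure (L2w \<alpha>) (L2w_inner \<alpha>) (pre_minimal_operator \<alpha> D A)"

text \<open>The operator function whose derivative is taken: \<open>2 Re A(t) - (\<alpha>'(t) / \<alpha>(t)) I\<close>.\<close>

definition real_part_shifted ::
    "(real \<Rightarrow> real) \<Rightarrow> (real \<Rightarrow> real) \<Rightarrow> (real \<Rightarrow> ('h::chilbert_space \<times> 'h) set) \<Rightarrow>
      real \<Rightarrow> ('h \<times> 'h) set" where
  "real_part_shifted \<alpha> \<alpha>' A t =
     op_diff (op_scale 2 (op_Re (A t))) (op_scale (complex_of_real (\<alpha>' t / \<alpha> t)) Id)"

definition self_commutator :: "('h::chilbert_space \<times> 'h) set \<Rightarrow> ('h \<times> 'h) set" where
  "self_commutator S = op_diff (op_mult (adj S) S) (op_mult S (adj S))"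

end

theory Submission
  imports Defs "HOL-Real_Asymp.Real_Asymp"
begin

text \<open>
  Write \<open>A\<close> for \<open>A(t)\<close> and \<open>C = 2 Re A - (\<alpha>'/\<alpha>) I\<close>. Test the minimal operator on \<open>u = \<phi> f\<close> with
  \<open>f \<in> D(A)\<close> and a real test function \<open>\<phi>\<close>. Formal normality provides \<open>w = L\<^sub>0\<^sup>* u\<close>, and the weak
  formulation of the adjoint forces \<open>w = \<phi> A\<^sup>* f - \<phi>' f - (\<alpha>'/\<alpha>) \<phi> f\<close> for almost every \<open>t\<close>. In
  \<open>\<parallel>L\<^sub>0 u\<parallel>\<^sup>2 = \<parallel>L\<^sub>0\<^sup>* u\<parallel>\<^sup>2\<close> the terms with \<open>\<phi>'\<^sup>2\<close> cancel, and the mixed terms add up to \<open>\<alpha> \<langle>C f, f\<rangle> (\<phi>\<^sup>2)'\<close>.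
  Integrating these by parts leaves
  \<open>\<integral> \<phi>\<^sup>2 \<alpha> (\<parallel>A f\<parallel>\<^sup>2 - \<parallel>A\<^sup>* f\<parallel>\<^sup>2 - \<langle>C f, f\<rangle>') dt = 0\<close>. Here the terms in which
  the integration by parts differentiates \<open>\<alpha>\<close> cancel those with \<open>\<alpha>'/\<alpha>\<close> in \<open>w\<close>. Since \<open>\<phi>\<close> is
  arbitrary, the bracket vanishes almost everywhere (\<open>adjoint_pointwise\<close>), and polarisation turns it into the commutator identity.

  Two difficulties remain. So far \<open>f\<close> is known to lie in \<open>D(A\<^sup>*(t))\<close> only for almost every \<open>t\<close>, whereas
  a derivative in \<open>t\<close> looks at all nearby times; and the exceptional null set depends on \<open>f\<close>. Both are
  settled by the function \<open>\<parallel>A f\<parallel>\<^sup>2 - \<langle>C f, f\<rangle>'\<close>, which does not mention the adjoint and is continuous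
  where \<open>\<alpha> > 0\<close>. As it equals \<open>\<parallel>A\<^sup>* f\<parallel>\<^sup>2\<close> almost everywhere, the inequality
  \<open>\<bar>\<langle>A g, f\<rangle>\<bar>\<^sup>2 \<le> \<parallel>g\<parallel>\<^sup>2 (\<parallel>A f\<parallel>\<^sup>2 - \<langle>C f, f\<rangle>')\<close> holds almost everywhere, hence by continuity wherever
  \<open>\<alpha> > 0\<close> (\<open>adjoint_bound\<close>), and the Riesz argument puts all of \<open>D(A)\<close> into \<open>D(A\<^sup>*(t))\<close> with a bound on
  \<open>\<parallel>A\<^sup>* f\<parallel>\<close>. For the null set, the curves \<open>t \<mapsto> (f, A(t) f, A'(t) f)\<close>, \<open>f \<in> D(A)\<close>, form a separable
  set for uniform convergence. One null set therefore serves a countable \<open>G \<subseteq> D(A)\<close> whose curves are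
  dense, and that bound carries the identity from \<open>G\<close> to \<open>D(A)\<close> (\<open>AE_norm_adj_act\<close>).

  The closure in the definition of \<open>Re A\<close> is harmless: \<open>A + A\<^sup>*\<close> is symmetric on \<open>D(A)\<close>, so every value
  of its closure at \<open>f \<in> D(A)\<close> has the same inner products with \<open>D(A)\<close> (\<open>real_part_shifted_form\<close>). Thus
  the derivative of \<open>C(t) f\<close> is computed against \<open>D(A)\<close>, where only \<open>A(t)\<close> occurs.
\<close>

section \<open>Complex Hilbert spaces\<close>

lemma scaleC_of_real: "complex_of_real r *\<^sub>C x = r *\<^sub>R (x :: 'h::chilbert_space)"
  by (simp add: scaleR_scaleC)

lemma cinner_add_right: "cinner x (y + z) = cinner x y + cinner x (z :: 'h::chilbert_space)"
  by (metis cinner_add_left cinner_commute complex_cnj_add)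

lemma cinner_scaleC_right: "cinner x (c *\<^sub>C y) = cnj c * cinner x (y :: 'h::chilbert_space)"
  by (metis cinner_commute cinner_scaleC_left complex_cnj_mult)

lemma cinner_scaleR_left: "cinner (r *\<^sub>R x) y = r *\<^sub>R cinner x (y :: 'h::chilbert_space)"
  by (simp add: scaleR_scaleC cinner_scaleC_left scaleR_conv_of_real)

lemma cinner_scaleR_right: "cinner x (r *\<^sub>R y) = r *\<^sub>R cinner x (y :: 'h::chilbert_space)"
  by (simp add: scaleR_scaleC cinner_scaleC_right scaleR_conv_of_real)

lemma cinner_Cauchy_Schwarz: "norm (cinner x y) \<le> norm x * norm (y :: 'h::chilbert_space)"
proof (cases "y = 0")
  case True
  then show ?thesis
    using cinner_scaleR_right[of x 0 y] by simp
next
  case False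
  define s where "s = cinner x y"
  \<comment> \<open>\<open>c y\<close> is the projection of \<open>x\<close> onto the line of \<open>y\<close>\<close>
  define c where "c = s / complex_of_real ((norm y)\<^sup>2)"
  define z where "z = x + (- c) *\<^sub>C y"
  have ny: "(norm y)\<^sup>2 > 0" using False by simp
  have cyx: "cinner y x = cnj s" by (simp add: s_def cinner_commute[of y x])
  have "cinner z z = complex_of_real ((norm x)\<^sup>2) - c * cnj s - cnj c * s
        + c * cnj c * complex_of_real ((norm y)\<^sup>2)"
    unfolding z_def cinner_add_left cinner_add_right cinner_scaleC_left cinner_scaleC_right
      cyx s_def[symmetric]
    by (simp add: cinner_self algebra_simps)
  also have "c * cnj c * complex_of_real ((norm y)\<^sup>2) = cnj c * s"
    using False by (simp add: c_def field_simps power2_eq_square)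
  finally have "cinner z z = complex_of_real ((norm x)\<^sup>2 - (norm s)\<^sup>2 / (norm y)\<^sup>2)"
    using complex_norm_square[of s] by (simp add: c_def)
  then have "(norm z)\<^sup>2 = (norm x)\<^sup>2 - (norm s)\<^sup>2 / (norm y)\<^sup>2"
    by (metis cinner_self of_real_eq_iff)
  then have "(norm s)\<^sup>2 / (norm y)\<^sup>2 \<le> (norm x)\<^sup>2"
    by (metis diff_ge_0_iff_ge zero_le_power2)
  then have "(norm s)\<^sup>2 \<le> (norm x * norm y)\<^sup>2"
    using ny by (simp add: divide_le_eq power_mult_distrib)
  then show ?thesis
    unfolding s_def by (rule power2_le_imp_le) simp
qed

interpretation cinner: bounded_bilinear "cinner :: 'h::chilbert_space \<Rightarrow> 'h \<Rightarrow> complex"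
  by standard
    (use cinner_Cauchy_Schwarz in
      \<open>auto simp: cinner_add_left cinner_add_right cinner_scaleR_left cinner_scaleR_right
            intro!: exI[of _ 1]\<close>)

lemma norm_eq_Re_cinner: "(norm (x :: 'h::chilbert_space))\<^sup>2 = Re (cinner x x)"
  by (simp add: cinner_self)

lemma Re_cinner_commute: "Re (cinner y x) = Re (cinner x (y :: 'h::chilbert_space))"
  by (subst cinner_commute) simp

lemma norm_add_sq:
  "(norm (x + y :: 'h::chilbert_space))\<^sup>2 = (norm x)\<^sup>2 + 2 * Re (cinner x y) + (norm y)\<^sup>2"
  using Re_cinner_commute[of x y]
  by (simp add: norm_eq_Re_cinner cinner_add_left cinner_add_right)

lemma eq_if_cinner_eq_on_dense:
  fixes D :: "'h::chilbert_space set"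
  assumes "closure D = UNIV" and eq: "\<And>e. e \<in> D \<Longrightarrow> cinner x e = cinner y e"
  shows "x = y"
proof -
  have "continuous_on UNIV (\<lambda>e. cinner (x - y) e)"
    by (intro cinner.continuous_on continuous_intros)
  then have "cinner (x - y) e = 0" for e
    using continuous_constant_on_closure[of D "\<lambda>e. cinner (x - y) e" 0 e] assms
    by (simp add: cinner.diff_left)
  from this[of "x - y"] show ?thesis
    by (simp add: cinner_self)
qed

lemma norm_le_if_cinner_le_on_dense:
  fixes D :: "'h::chilbert_space set"
  assumes dense: "closure D = UNIV" and M: "0 \<le> M"
    and bound: "\<And>x. x \<in> D \<Longrightarrow> norm (cinner x z) \<le> M * norm x"
  shows "norm z \<le> M"
proof -
  obtain x where x: "\<And>n. x n \<in> D" "x \<longlonglongrightarrow> z"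
    using dense closure_sequential[of z D] by auto
  have "(\<lambda>n. norm (cinner (x n) z)) \<longlonglongrightarrow> norm (cinner z z)"
    by (intro tendsto_intros cinner.tendsto x)
  moreover have "(\<lambda>n. M * norm (x n)) \<longlonglongrightarrow> M * norm z"
    by (intro tendsto_intros x)
  ultimately have "norm (cinner z z) \<le> M * norm z"
    by (rule LIMSEQ_le) (use bound x in auto)
  then have le: "norm z * norm z \<le> M * norm z"
    by (simp add: cinner_self norm_mult power2_eq_square)
  then show ?thesis
    using M by (cases "z = 0") auto
qed

text \<open>
  The functional lives only on a subspace, which need not be closed. The minimising sequence of
  \<open>\<parallel>x\<parallel>\<^sup>2 - 2 Re l(x)\<close> over the subspace is nevertheless Cauchy in the whole space, and its limit
  represents \<open>l\<close>.
\<close>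

lemma Riesz_on_subspace:
  fixes D :: "'h::chilbert_space set" and l :: "'h \<Rightarrow> complex"
  assumes zero: "0 \<in> D"
    and add: "\<And>x y. x \<in> D \<Longrightarrow> y \<in> D \<Longrightarrow> x + y \<in> D"
    and scale: "\<And>c x. x \<in> D \<Longrightarrow> c *\<^sub>C x \<in> D"
    and l_add: "\<And>x y. x \<in> D \<Longrightarrow> y \<in> D \<Longrightarrow> l (x + y) = l x + l y"
    and l_scale: "\<And>c x. x \<in> D \<Longrightarrow> l (c *\<^sub>C x) = c * l x"
    and bound: "\<And>x. x \<in> D \<Longrightarrow> norm (l x) \<le> M * norm x"
  obtains z where "\<And>x. x \<in> D \<Longrightarrow> l x = cinner x z"
proof -
  define J where "J x = (norm x)\<^sup>2 - 2 * Re (l x)" for x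
  define m where "m = Inf (J ` D)"
  have scaleR: "r *\<^sub>R x \<in> D" and l_scaleR: "l (r *\<^sub>R x) = r *\<^sub>R l x" if "x \<in> D" for r x
    using that scale l_scale by (simp_all add: scaleR_scaleC scaleR_conv_of_real)
  have J_lower: "- M\<^sup>2 \<le> J x" if "x \<in> D" for x
  proof -
    have "Re (l x) \<le> M * norm x" using bound[OF that] complex_Re_le_cmod order_trans by blast
    then have "(norm x - M)\<^sup>2 - M\<^sup>2 \<le> J x"
      by (simp add: J_def power2_eq_square algebra_simps)
    then show ?thesis by (smt (verit) zero_le_power2)
  qed
  then have bdd: "bdd_below (J ` D)" by (intro bdd_belowI2)
  have m_le: "m \<le> J x" if "x \<in> D" for x
    unfolding m_def using that bdd by (simp add: cINF_lower)
  have "\<exists>x\<in>D. J x < m + inverse (real (Suc n))" for n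
  proof -
    have "Inf (J ` D) < m + inverse (real (Suc n))" by (simp add: m_def)
    then show ?thesis using zero bdd by (subst (asm) cInf_less_iff) auto
  qed
  then obtain x where x: "\<And>n. x n \<in> D" "\<And>n. J (x n) < m + inverse (real (Suc n))"
    by metis
  have Jx_lim: "(\<lambda>n. J (x n)) \<longlonglongrightarrow> m"
  proof (rule tendsto_sandwich[of "\<lambda>_. m" _ _ "\<lambda>n. m + inverse (real (Suc n))"])
    show "(\<lambda>n. m + inverse (real (Suc n))) \<longlonglongrightarrow> m"
      using tendsto_add[OF tendsto_const LIMSEQ_inverse_real_of_nat] by force
  qed (use m_le x in \<open>auto intro!: always_eventually less_imp_le\<close>)
  \<comment> \<open>the parallelogram law\<close>
  have para: "(norm (y - z))\<^sup>2 / 2 \<le> (J y - m) + (J z - m)" if "y \<in> D" "z \<in> D" for y z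
  proof -
    have "2 * m \<le> 2 * J ((1/2) *\<^sub>R (y + z))" using m_le that scaleR add by simp
    also have "\<dots> = (norm (y + z))\<^sup>2 / 2 - 2 * Re (l y) - 2 * Re (l z)"
      using that l_scaleR[of "y + z"] add l_add by (simp add: J_def power_mult_distrib power2_eq_square distrib_left
          del: scaleR_add_right)
    also have "(norm (y + z))\<^sup>2 = 2 * (norm y)\<^sup>2 + 2 * (norm z)\<^sup>2 - (norm (y - z))\<^sup>2"
      using norm_add_sq[of y z] norm_add_sq[of y "- z"] by (simp add: cinner.minus_right)
    finally show ?thesis by (simp add: J_def field_simps)
  qed
  have "Cauchy x"
  proof (rule metric_CauchyI)
    fix e :: real assume "e > 0"
    then obtain N where N: "inverse (real (Suc N)) < e\<^sup>2 / 4"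
      using reals_Archimedean[of "e\<^sup>2 / 4"] by auto
    show "\<exists>N. \<forall>i\<ge>N. \<forall>j\<ge>N. dist (x i) (x j) < e"
    proof (intro exI allI impI)
      fix i j assume ij: "N \<le> i" "N \<le> j"
      have inv: "inverse (real (Suc k)) \<le> inverse (real (Suc N))" if "N \<le> k" for k
        using that by (intro le_imp_inverse_le) auto
      have "(norm (x i - x j))\<^sup>2 / 2 < e\<^sup>2 / 4 + e\<^sup>2 / 4"
        using para[OF x(1) x(1), of i j] x(2)[of i] x(2)[of j] inv[OF ij(1)] inv[OF ij(2)] N
        by linarith
      then have "(norm (x i - x j))\<^sup>2 < e\<^sup>2" by simp
      then show "dist (x i) (x j) < e"
        using \<open>e > 0\<close> by (simp add: dist_norm power2_less_imp_less)
    qed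
  qed
  then obtain z where z: "x \<longlonglongrightarrow> z" using Cauchy_convergent convergent_def by blast
  have Re_eq: "Re (cinner h z) = Re (l h)" if h: "h \<in> D" for h
  proof -
    define b where "b = Re (cinner z h) - Re (l h)"
    \<comment> \<open>first variation of the functional at its minimiser in the direction \<open>h\<close>\<close>
    have "0 \<le> 2 * e * b + e\<^sup>2 * (norm h)\<^sup>2" for e
    proof -
      have "m \<le> J (x n) + 2 * e * (Re (cinner (x n) h) - Re (l h)) + e\<^sup>2 * (norm h)\<^sup>2" for n
        using m_le[of "x n + e *\<^sub>R h"] x(1)[of n] h
        by (simp add: add scaleR J_def norm_add_sq l_add l_scaleR cinner_scaleR_right power_mult_distrib
            algebra_simps)
      moreover have "(\<lambda>n. J (x n) + 2 * e * (Re (cinner (x n) h) - Re (l h)) + e\<^sup>2 * (norm h)\<^sup>2)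
          \<longlonglongrightarrow> m + 2 * e * b + e\<^sup>2 * (norm h)\<^sup>2"
        unfolding b_def by (intro tendsto_intros Jx_lim cinner.tendsto z)
      ultimately have "m \<le> m + 2 * e * b + e\<^sup>2 * (norm h)\<^sup>2"
        by (intro LIMSEQ_le_const) auto
      then show ?thesis by simp
    qed
    note q = this
    have "b = 0"
    proof (cases "h = 0")
      case True
      then show ?thesis
        using q[of 1] q[of "-1"] by simp
    next
      case False
      then have "(norm h)\<^sup>2 > 0" by simp
      have "2 * (- b / (norm h)\<^sup>2) * b + (- b / (norm h)\<^sup>2)\<^sup>2 * (norm h)\<^sup>2 = - (b\<^sup>2 / (norm h)\<^sup>2)"
        using False by (simp add: power2_eq_square field_simps)
      then have "b\<^sup>2 / (norm h)\<^sup>2 \<le> 0"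
        using q[of "- b / (norm h)\<^sup>2"] by linarith
      then show ?thesis
        using \<open>(norm h)\<^sup>2 > 0\<close> by (simp add: divide_le_0_iff)
    qed
    then show ?thesis by (simp add: b_def Re_cinner_commute)
  qed
  show ?thesis
  proof (rule that)
    fix h assume h: "h \<in> D"
    \<comment> \<open>the real part at \<open>\<i> h\<close> is minus the imaginary part at \<open>h\<close>\<close>
    have "Re (cinner (\<i> *\<^sub>C h) z) = Re (l (\<i> *\<^sub>C h))"
      by (rule Re_eq) (rule scale[OF h])
    then show "l h = cinner h z"
      using Re_eq[OF h] by (simp add: l_scale[OF h] cinner_scaleC_left complex_eq_iff)
  qed
qed

lemma bounded_linear_scaleC: "bounded_linear (\<lambda>x. c *\<^sub>C x :: 'h::chilbert_space)"
proof
  show "c *\<^sub>C (x + y) = c *\<^sub>C x + c *\<^sub>C y" for x y :: 'h by (rule scaleC_add_right)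
  show "c *\<^sub>C (r *\<^sub>R x) = r *\<^sub>R (c *\<^sub>C x)" for r and x :: 'h
    by (simp add: scaleR_scaleC scaleC_scaleC mult.commute)
  have "norm (c *\<^sub>C x) = cmod c * norm x" for x :: 'h
  proof -
    have "complex_of_real ((norm (c *\<^sub>C x))\<^sup>2) = c * cnj c * complex_of_real ((norm x)\<^sup>2)"
      unfolding cinner_self[symmetric] by (simp add: cinner_scaleC_left cinner_scaleC_right)
    also have "\<dots> = complex_of_real ((cmod c * norm x)\<^sup>2)"
      using complex_norm_square[of c] by (simp add: power_mult_distrib)
    finally have "(norm (c *\<^sub>C x))\<^sup>2 = (cmod c * norm x)\<^sup>2" unfolding of_real_eq_iff .
    then show ?thesis by (rule power2_eq_imp_eq) simp_all
  qed
  then show "\<exists>K. \<forall>x :: 'h. norm (c *\<^sub>C x) \<le> norm x * K"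
    by (intro exI[of _ "cmod c"]) (simp add: mult.commute)
qed

section \<open>Test functions\<close>

definition smooth :: "(real \<Rightarrow> real) \<Rightarrow> bool" where
  "smooth f \<longleftrightarrow>
     (\<exists>F :: nat \<Rightarrow> real \<Rightarrow> real. F 0 = f \<and> (\<forall>k t. (F k has_real_derivative F (Suc k) t) (at t)))"

lemma smooth_derivative:
  assumes "smooth f"
  obtains f' where "smooth f'" "\<And>t. (f has_real_derivative f' t) (at t)"
proof -
  obtain F where F: "F 0 = f" "\<And>k t. (F k has_real_derivative F (Suc k) t) (at t)"
    using assms unfolding smooth_def by blast
  then have "smooth (F 1)"
    unfolding smooth_def by (intro exI[of _ "\<lambda>k. F (Suc k)"]) simp
  then show ?thesis using that[of "F 1"] F(1) F(2)[of 0] by simp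
qed

lemma smooth_if_derivative_closed:
  assumes "f \<in> S" and closed: "\<And>f. f \<in> S \<Longrightarrow> \<exists>f'\<in>S. \<forall>t. (f has_real_derivative f' t) (at t)"
  shows "smooth f"
proof -
  obtain d where d: "\<And>f. f \<in> S \<Longrightarrow> d f \<in> S \<and> (\<forall>t. (f has_real_derivative d f t) (at t))"
    using closed by metis
  have "(d ^^ k) f \<in> S" for k
    using assms(1) d by (induction k) auto
  then show ?thesis
    using d unfolding smooth_def by (intro exI[of _ "\<lambda>k. (d ^^ k) f"]) simp
qed

text \<open>
  Smoothness of products without the Leibniz formula: the ring generated by the smooth functions is
  closed under differentiation.
\<close>

inductive_set smooth_ring :: "(real \<Rightarrow> real) set" where
  base: "smooth f \<Longrightarrow> f \<in> smooth_ring"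
| sum: "f \<in> smooth_ring \<Longrightarrow> g \<in> smooth_ring \<Longrightarrow> (\<lambda>x. f x + g x) \<in> smooth_ring"
| prod: "f \<in> smooth_ring \<Longrightarrow> g \<in> smooth_ring \<Longrightarrow> (\<lambda>x. f x * g x) \<in> smooth_ring"

lemma smooth_ring_derivative:
  "f \<in> smooth_ring \<Longrightarrow> \<exists>f'\<in>smooth_ring. \<forall>t. (f has_real_derivative f' t) (at t)"
proof (induction rule: smooth_ring.induct)
  case (base f)
  then show ?case by (meson smooth_derivative smooth_ring.base)
next
  case (sum f g)
  then obtain f' g' where "f' \<in> smooth_ring" "g' \<in> smooth_ring"
    "\<And>t. (f has_real_derivative f' t) (at t)" "\<And>t. (g has_real_derivative g' t) (at t)" by blast
  then show ?case
    by (intro bexI[of _ "\<lambda>t. f' t + g' t"]) (auto intro: smooth_ring.sum DERIV_add)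
next
  case (prod f g)
  then obtain f' g' where "f' \<in> smooth_ring" "g' \<in> smooth_ring"
    "\<And>t. (f has_real_derivative f' t) (at t)" "\<And>t. (g has_real_derivative g' t) (at t)" by blast
  then show ?case using prod
    by (intro bexI[of _ "\<lambda>t. f' t * g t + g' t * f t"])
      (auto intro: smooth_ring.sum smooth_ring.prod DERIV_mult)
qed

lemma smooth_mult: "smooth f \<Longrightarrow> smooth g \<Longrightarrow> smooth (\<lambda>x. f x * g x)"
  by (rule smooth_if_derivative_closed[OF _ smooth_ring_derivative])
    (intro smooth_ring.base smooth_ring.prod)

definition real_test :: "(real \<Rightarrow> real) \<Rightarrow> bool" where
  "real_test \<psi> \<longleftrightarrow>
     smooth \<psi> \<and> (\<exists>K. compact K \<and> K \<subseteq> {0<..<1} \<and> (\<forall>t. t \<notin> K \<longrightarrow> \<psi> t = 0))"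

lemma real_test_imp_test_function:
  assumes "real_test \<psi>"
  shows "test_function (\<lambda>t. complex_of_real (\<psi> t))"
proof -
  obtain F where F: "F 0 = \<psi>" "\<And>k t. (F k has_real_derivative F (Suc k) t) (at t)"
    using assms unfolding real_test_def smooth_def by blast
  have "((\<lambda>t. complex_of_real (F k t)) has_vector_derivative complex_of_real (F (Suc k) t)) (at t)"
    for k t
    using F(2) by (intro has_vector_derivative_of_real)
      (simp add: has_real_derivative_iff_has_vector_derivative)
  then show ?thesis
    using assms F(1) unfolding test_function_def real_test_def
    by (intro conjI exI[of _ "\<lambda>k t. complex_of_real (F k t)"]) auto
qed

lemma real_test_derivative:
  assumes "real_test \<psi>"
  obtains \<psi>' where "real_test \<psi>'" "\<And>t. (\<psi> has_real_derivative \<psi>' t) (at t)"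
proof -
  obtain \<psi>' where d: "smooth \<psi>'" "\<And>t. (\<psi> has_real_derivative \<psi>' t) (at t)"
    using assms smooth_derivative unfolding real_test_def by blast
  obtain K where K: "compact K" "K \<subseteq> {0<..<1}" "\<And>t. t \<notin> K \<Longrightarrow> \<psi> t = 0"
    using assms unfolding real_test_def by blast
  have "\<psi>' t = 0" if "t \<notin> K" for t
  proof -
    have "open (- K)" using K(1) by (simp add: compact_imp_closed open_Compl)
    then have "((\<lambda>_. 0) has_real_derivative \<psi>' t) (at t)"
      by (rule has_field_derivative_transform_within_open[OF d(2)]) (use K(3) that in auto)
    from DERIV_unique[OF this DERIV_const] show ?thesis .
  qed
  then have "real_test \<psi>'"
    unfolding real_test_def using K d(1) by blast
  then show ?thesis using that d(2) by simp
qed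

lemma real_test_outside: "real_test \<psi> \<Longrightarrow> t \<notin> {0<..<1} \<Longrightarrow> \<psi> t = 0"
  unfolding real_test_def by blast

lemma real_test_continuous:
  assumes "real_test \<psi>"
  shows "continuous_on S \<psi>"
proof -
  obtain \<psi>' where "\<And>t. (\<psi> has_real_derivative \<psi>' t) (at t)"
    using real_test_derivative[OF assms] by blast
  then have "isCont \<psi> t" for t by (rule DERIV_isCont)
  then show ?thesis by (intro continuous_at_imp_continuous_on ballI)
qed

lemma real_test_mult:
  assumes "real_test \<phi>" "real_test \<psi>"
  shows "real_test (\<lambda>t. \<phi> t * \<psi> t)"
proof -
  obtain K where "compact K" "K \<subseteq> {0<..<1}" "\<And>t. t \<notin> K \<Longrightarrow> \<psi> t = 0"
    using assms(2) unfolding real_test_def by blast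
  then show ?thesis
    using assms smooth_mult unfolding real_test_def by (auto intro!: exI[of _ K])
qed

text \<open>
  The functions \<open>p(1/x) exp(-1/x)\<close>, extended by zero to \<open>x \<le> 0\<close>. Admitting an arbitrary polynomial
  \<open>p\<close> makes the class closed under differentiation, including at the origin.
\<close>

definition exp_inv :: "real poly \<Rightarrow> real \<Rightarrow> real" where
  "exp_inv p x = (if x > 0 then poly p (1 / x) * exp (- (1 / x)) else 0)"

lemma exp_inv_nonpos: "x \<le> 0 \<Longrightarrow> exp_inv p x = 0"
  by (simp add: exp_inv_def)

lemma poly_times_exp_neg: "((\<lambda>y. poly p y * exp (- y)) \<longlongrightarrow> (0::real)) at_top"
proof -
  have "((\<lambda>y. \<Sum>i\<le>degree p. coeff p i * (y ^ i / exp y)) \<longlongrightarrow> (\<Sum>i\<le>degree p. coeff p i * 0)) at_top"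
    by (intro tendsto_intros tendsto_power_div_exp_0)
  then show ?thesis
    by (simp add: poly_altdef exp_minus sum_distrib_right divide_inverse mult.assoc)
qed

lemma exp_inv_derivative:
  "(exp_inv p has_real_derivative exp_inv ([:0, 0, 1:] * (p - pderiv p)) x) (at x)"
proof (cases x "0 :: real" rule: linorder_cases)
  case less
  have "((\<lambda>_. 0) has_real_derivative 0) (at x)" by simp
  then have "(exp_inv p has_real_derivative 0) (at x)"
    by (rule has_field_derivative_transform_within_open[of _ _ _ "{..<0}"])
      (use less in \<open>auto simp: exp_inv_def\<close>)
  then show ?thesis using less by (simp add: exp_inv_def)
next
  case greater
  have "((\<lambda>x. poly p (1 / x) * exp (- (1 / x))) has_real_derivative
      (poly (pderiv p) (1 / x) * (- 1 / x\<^sup>2)) * exp (- (1 / x))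
      + (exp (- (1 / x)) * (1 / x\<^sup>2)) * poly p (1 / x)) (at x)"
    using greater by (auto intro!: derivative_eq_intros simp: power2_eq_square field_simps)
  then have "(exp_inv p has_real_derivative
      (poly (pderiv p) (1 / x) * (- 1 / x\<^sup>2)) * exp (- (1 / x))
      + (exp (- (1 / x)) * (1 / x\<^sup>2)) * poly p (1 / x)) (at x)"
    by (rule has_field_derivative_transform_within_open[of _ _ _ "{0<..}"])
      (use greater in \<open>auto simp: exp_inv_def\<close>)
  also have "(poly (pderiv p) (1 / x) * (- 1 / x\<^sup>2)) * exp (- (1 / x))
      + (exp (- (1 / x)) * (1 / x\<^sup>2)) * poly p (1 / x) = exp_inv ([:0, 0, 1:] * (p - pderiv p)) x"
    using greater by (simp add: exp_inv_def power2_eq_square field_simps)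
  finally show ?thesis .
next
  case equal
  \<comment> \<open>on the right, the quotient is again a polynomial in \<open>1/h\<close> times \<open>exp(-1/h)\<close>\<close>
  have "((\<lambda>h. exp_inv p h / h) \<longlongrightarrow> 0) (at 0)"
  proof (subst filterlim_at_split, intro conjI)
    show "((\<lambda>h. exp_inv p h / h) \<longlongrightarrow> 0) (at_left 0)"
      by (rule tendsto_eventually) (auto simp: eventually_at_left_field exp_inv_def intro: exI[of _ "-1"])
    have "((\<lambda>h. poly ([:0, 1:] * p) (inverse h) * exp (- inverse h)) \<longlongrightarrow> (0::real)) (at_right 0)"
      using filterlim_compose[OF poly_times_exp_neg filterlim_inverse_at_top_right] .
    then show "((\<lambda>h. exp_inv p h / h) \<longlongrightarrow> 0) (at_right 0)"
      by (rule Lim_transform_eventually)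
        (auto simp: eventually_at_right_field exp_inv_def field_simps intro: exI[of _ 1])
  qed
  then show ?thesis
    using equal by (simp add: has_field_derivative_iff exp_inv_def)
qed


lemma smooth_exp_inv_affine: "smooth (\<lambda>x. exp_inv p (c * x + d))"
proof (rule smooth_if_derivative_closed)
  show "(\<lambda>x. exp_inv p (c * x + d)) \<in> range (\<lambda>p x. exp_inv p (c * x + d))" by blast
next
  fix f assume "f \<in> range (\<lambda>p x. exp_inv p (c * x + d))"
  then obtain p where f: "f = (\<lambda>x. exp_inv p (c * x + d))" by blast
  have "(f has_real_derivative
      exp_inv ([:0, 0, 1:] * (p - pderiv p)) (c * t + d) * c) (at t)" for t
    unfolding f by (rule DERIV_chain2[OF exp_inv_derivative]) (auto intro!: derivative_eq_intros)
  moreover have "exp_inv ([:0, 0, 1:] * (p - pderiv p)) (c * t + d) * c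
      = exp_inv (smult c ([:0, 0, 1:] * (p - pderiv p))) (c * t + d)" for t
    by (simp add: exp_inv_def)
  ultimately show "\<exists>f'\<in>range (\<lambda>p x. exp_inv p (c * x + d)). \<forall>t. (f has_real_derivative f' t) (at t)"
    by (auto intro!: exI[of _ "smult c ([:0, 0, 1:] * (p - pderiv p))"])
qed

text \<open>
  The shift by \<open>-1\<close> makes the support of the bump \<open>[a + 1/(n+1), b - 1/(n+1)]\<close>, so that it is a
  compact subset of \<open>(0,1)\<close> even for \<open>a = 0\<close> and \<open>b = 1\<close>; the slope \<open>n + 1\<close> makes the bumps converge to
  the indicator function of \<open>(a,b)\<close>.
\<close>

definition bump :: "real \<Rightarrow> real \<Rightarrow> nat \<Rightarrow> real \<Rightarrow> real" where
  "bump a b n x = exp_inv 1 (real (Suc n) * (x - a) - 1) * exp_inv 1 (real (Suc n) * (b - x) - 1)"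

lemma bump_nonneg: "0 \<le> bump a b n x" and bump_le_1: "bump a b n x \<le> 1"
proof -
  have "0 \<le> exp_inv 1 y \<and> exp_inv 1 y \<le> 1" for y
    by (simp add: exp_inv_def)
  then show "0 \<le> bump a b n x" "bump a b n x \<le> 1"
    unfolding bump_def by (auto intro!: mult_nonneg_nonneg mult_le_one)
qed

lemma real_test_bump:
  assumes "0 \<le> a" "b \<le> 1"
  shows "real_test (bump a b n)"
proof -
  have "smooth (\<lambda>x. exp_inv 1 (real (Suc n) * x + (- real (Suc n) * a - 1))
      * exp_inv 1 (- real (Suc n) * x + (real (Suc n) * b - 1)))"
    by (intro smooth_mult smooth_exp_inv_affine)
  also have "(\<lambda>x. exp_inv 1 (real (Suc n) * x + (- real (Suc n) * a - 1))
      * exp_inv 1 (- real (Suc n) * x + (real (Suc n) * b - 1))) = bump a b n"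
    by (simp add: bump_def fun_eq_iff algebra_simps)
  finally have "smooth (bump a b n)" .
  moreover have "bump a b n x = 0" if "x \<notin> {a + 1 / real (Suc n)..b - 1 / real (Suc n)}" for x
  proof -
    have "real (Suc n) * (x - a) - 1 \<le> 0 \<or> real (Suc n) * (b - x) - 1 \<le> 0"
      using that by (auto simp: field_simps)
    then show ?thesis
      by (elim disjE) (simp_all only: bump_def exp_inv_nonpos mult_zero_left mult_zero_right)
  qed
  moreover have "{a + 1 / real (Suc n)..b - 1 / real (Suc n)} \<subseteq> {0<..<1}"
  proof
    fix x assume "x \<in> {a + 1 / real (Suc n)..b - 1 / real (Suc n)}"
    moreover have "0 < 1 / real (Suc n)" by simp
    ultimately show "x \<in> {0<..<1}"
      using assms unfolding atLeastAtMost_iff greaterThanLessThan_iff by linarith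
  qed
  ultimately show ?thesis
    unfolding real_test_def by (metis compact_Icc)
qed

lemma bump_tendsto_indicator: "(\<lambda>n. bump a b n x) \<longlonglongrightarrow> indicator {a<..<b} x"
proof (cases "x \<in> {a<..<b}")
  case True
  have "(\<lambda>n. exp_inv 1 (real (Suc n) * y - 1)) \<longlonglongrightarrow> 1" if "y > 0" for y
  proof -
    have lim: "filterlim (\<lambda>n. real (Suc n) * y - 1) at_top sequentially"
      using that by real_asymp
    then have "(\<lambda>n. exp (- inverse (real (Suc n) * y - 1))) \<longlonglongrightarrow> exp (- 0)"
      by (intro tendsto_intros tendsto_inverse_0_at_top)
    then have "(\<lambda>n. exp (- inverse (real (Suc n) * y - 1))) \<longlonglongrightarrow> 1" by simp
    then show ?thesis
    proof (rule Lim_transform_eventually)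
      show "\<forall>\<^sub>F n in sequentially. exp (- inverse (real (Suc n) * y - 1)) = exp_inv 1 (real (Suc n) * y - 1)"
        using filterlim_at_top_dense[THEN iffD1, OF lim, rule_format, of 0]
        by eventually_elim (simp add: exp_inv_def divide_inverse)
    qed
  qed
  from tendsto_mult[OF this[of "x - a"] this[of "b - x"]] show ?thesis
    using True by (simp add: bump_def)
next
  case False
  then have le: "real (Suc n) * (x - a) - 1 \<le> 0 \<or> real (Suc n) * (b - x) - 1 \<le> 0" for n
    using mult_nonneg_nonpos[of "real (Suc n)" "x - a"] mult_nonneg_nonpos[of "real (Suc n)" "b - x"]
    by auto
  have "bump a b n x = 0" for n
    using le[of n]
    by (elim disjE) (simp_all only: bump_def exp_inv_nonpos mult_zero_left mult_zero_right)
  then show ?thesis using False by simp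
qed

lemma AE_lebesgue_on_if_AE_lebesgue:
  "AE t in lebesgue. P t \<Longrightarrow> AE t in lebesgue_on {0<..<1::real}. P t"
  by (auto simp: AE_restrict_space_iff elim: eventually_mono)

text \<open>
  The fundamental lemma of the calculus of variations. Only squares of test functions are available
  in the energy balance. The squares of the bumps still converge boundedly to the indicator functions of
  intervals, and intervals generate the Borel sets.
\<close>

lemma AE_zero_if_test_integrals_zero:
  fixes k :: "real \<Rightarrow> 'b::{banach, second_countable_topology}"
  defines "M \<equiv> lebesgue_on {0<..<1::real}"
  assumes int: "integrable M k"
    and zero: "\<And>\<psi>. real_test \<psi> \<Longrightarrow> (LINT t|M. (\<psi> t)\<^sup>2 *\<^sub>R k t) = 0"
  shows "AE t in M. k t = 0"
proof -
  have "finite_measure M"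
    unfolding M_def by (rule finite_measure_lebesgue_on) simp
  then interpret finite_measure M .
  show ?thesis
  proof (rule density_zero[OF int])
    have meas: "B \<inter> {0<..<1} \<in> sets M" if "B \<in> sets borel" for B
      using that unfolding M_def by (simp add: sets_restrict_space_iff)
    have ind: "indicator B \<in> borel_measurable M" if "B \<in> sets borel" for B :: "real set"
      using that unfolding M_def
      by (intro measurable_restrict_space1) (simp add: measurable_completion)
    have int_B: "integrable M (\<lambda>t. indicator B t *\<^sub>R k t)" if "B \<in> sets borel" for B :: "real set"
      by (rule Bochner_Integration.integrable_bound[OF int])
        (use ind[OF that] int in \<open>auto split: split_indicator intro!: borel_measurable_scaleR\<close>)
    have interval: "(LINT t|M. indicator {a<..<b} t *\<^sub>R k t) = 0" for a b
    proof -
      \<comment> \<open>only the part of the interval inside \<open>(0,1)\<close> matters, and there the bumps are test functions\<close>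
      let ?p = "bump (max a 0) (min b 1)"
      have "(\<lambda>n. LINT t|M. (?p n t)\<^sup>2 *\<^sub>R k t) \<longlonglongrightarrow> (LINT t|M. indicator {a<..<b} t *\<^sub>R k t)"
      proof (rule integral_dominated_convergence)
        show "AE t in M. (\<lambda>n. (?p n t)\<^sup>2 *\<^sub>R k t) \<longlonglongrightarrow> indicator {a<..<b} t *\<^sub>R k t"
        proof (rule AE_I2)
          fix t assume "t \<in> space M"
          then have "indicat_real {a<..<b} t = (indicat_real {max a 0<..<min b 1} t)\<^sup>2"
            by (auto simp: M_def indicator_def)
          then show "(\<lambda>n. (?p n t)\<^sup>2 *\<^sub>R k t) \<longlonglongrightarrow> indicator {a<..<b} t *\<^sub>R k t"
            by (simp only:) (intro tendsto_intros bump_tendsto_indicator)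
        qed
        show "AE t in M. norm ((?p n t)\<^sup>2 *\<^sub>R k t) \<le> norm (k t)" for n
          using bump_nonneg bump_le_1
          by (intro AE_I2) (auto intro!: mult_left_le_one_le power_le_one)
        show "(\<lambda>t. (?p n t)\<^sup>2 *\<^sub>R k t) \<in> borel_measurable M" for n
        proof -
          have "?p n \<in> borel_measurable M"
            unfolding M_def
            by (intro continuous_imp_measurable_on_sets_lebesgue real_test_continuous real_test_bump) auto
          then show ?thesis using int by measurable
        qed
      qed (use int ind int_B in auto)
      moreover have "(LINT t|M. (?p n t)\<^sup>2 *\<^sub>R k t) = 0" for n
        by (intro zero real_test_bump) auto
      ultimately show ?thesis by (simp add: LIMSEQ_const_iff)
    qed
    have whole: "(LINT t|M. k t) = 0"
    proof -
      have "(LINT t|M. k t) = (LINT t|M. indicator {-1<..<2} t *\<^sub>R k t)"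
        by (rule Bochner_Integration.integral_cong) (auto simp: M_def)
      then show ?thesis using interval by simp
    qed
    have gen: "sets (borel :: real measure) = sigma_sets UNIV (range (\<lambda>(a, b). {a<..<b}))"
      unfolding borel_eq_box[where 'a = real] box_real by simp
    have borel: "(LINT t|M. indicator B t *\<^sub>R k t) = 0" if "B \<in> sets borel" for B :: "real set"
    proof -
      have "Int_stable (range (\<lambda>(a, b). {a<..<b :: real}))"
        by (auto simp: Int_stable_def)
      moreover have "range (\<lambda>(a, b). {a<..<b :: real}) \<subseteq> Pow UNIV" by auto
      moreover have "B \<in> sigma_sets UNIV (range (\<lambda>(a, b). {a<..<b :: real}))"
        using that by (simp add: gen)
      ultimately show ?thesis
      proof (induction rule: sigma_sets_induct_disjoint)
        case (basic A)
        then show ?case using interval by auto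
      next
        case empty
        then show ?case by simp
      next
        case (compl A)
        then have A: "A \<in> sets borel" by (simp add: gen)
        have "(\<lambda>t. indicator (UNIV - A) t *\<^sub>R k t) = (\<lambda>t. k t - indicator A t *\<^sub>R k t)"
          by (auto simp: indicator_def)
        then show ?case
          using compl int int_B[OF A] whole by simp
      next
        case (union A)
        then have A: "A i \<in> sets borel" for i by (auto simp: gen)
        have "set_lebesgue_integral M (\<Union>i. A i \<inter> {0<..<1}) k
            = (\<Sum>i. set_lebesgue_integral M (A i \<inter> {0<..<1}) k)"
        proof (rule lebesgue_integral_countable_add)
          show "set_integrable M (\<Union>i. A i \<inter> {0<..<1}) k"
            unfolding set_integrable_def using int_B[of "\<Union>i. A i \<inter> {0<..<1}"] A by auto
          show "A i \<inter> {0<..<1} \<inter> (A j \<inter> {0<..<1}) = {}" if "i \<noteq> j" for i j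
            using union(1) that by (auto simp: disjoint_family_on_def)
        qed (use meas A in auto)
        moreover have "set_lebesgue_integral M (C \<inter> {0<..<1}) k = (LINT t|M. indicator C t *\<^sub>R k t)" for C
          unfolding set_lebesgue_integral_def
          by (rule Bochner_Integration.integral_cong) (auto simp: M_def indicator_def)
        ultimately show ?case
          using union by (simp flip: Int_UN_distrib2)
      qed
    qed
    fix A assume A: "A \<in> sets M"
    then have "A \<in> sets lebesgue" unfolding M_def by (simp add: sets_restrict_space_iff)
    then obtain S N N' where S: "A = S \<union> N" "N \<subseteq> N'" "N' \<in> null_sets lborel" "S \<in> sets lborel"
      by (rule sets_completionE)
    have "N' \<in> null_sets lebesgue" using S(3) by (rule null_sets_completionI)
    then have "AE t in lebesgue. t \<notin> N'" by (rule AE_not_in)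
    then have "AE t in M. t \<notin> N'" unfolding M_def by (rule AE_lebesgue_on_if_AE_lebesgue)
    then have "AE t in M. indicator A t *\<^sub>R k t = indicator S t *\<^sub>R k t"
      by eventually_elim (use S in \<open>auto simp: indicator_def\<close>)
    then have "set_lebesgue_integral M A k = (LINT t|M. indicator S t *\<^sub>R k t)"
      unfolding set_lebesgue_integral_def
      using int A int_B[of S] S(4)
      by (intro integral_cong_AE) auto
    then show "set_lebesgue_integral M A k = 0" using borel S(4) by simp
  qed
qed


section \<open>Uniform approximation from a countable set\<close>

text \<open>
  Separability of the space of continuous curves, in the form that a family of curves has a countable
  subfamily that is uniformly dense in it. A finite list of points of a countable dense set encodes a step
  function; for every step function within \<open>1/(k+1)\<close> of some member of the family choose one such member.
\<close>

lemma countable_uniformly_dense_subset: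
  fixes u :: "'i \<Rightarrow> real \<Rightarrow> 'x::{metric_space, second_countable_topology}"
  assumes cont: "\<And>i. i \<in> I \<Longrightarrow> continuous_on {0..1} (u i)"
  obtains J where "J \<subseteq> I" "countable J"
    "\<And>i e. i \<in> I \<Longrightarrow> e > 0 \<Longrightarrow> \<exists>j\<in>J. \<forall>t\<in>{0..1}. dist (u i t) (u j t) < e"
proof -
  obtain Q :: "'x set" where Q: "countable Q" "\<And>X. open X \<Longrightarrow> X \<noteq> {} \<Longrightarrow> \<exists>x\<in>Q. x \<in> X"
    using countable_dense_setE by blast
  define fits where "fits p i \<longleftrightarrow> (case p of (k, xs) \<Rightarrow> i \<in> I \<and>
      (\<forall>t\<in>{0..1}. dist (u i t) (xs ! nat \<lfloor>t * real (length xs - 1)\<rfloor>) < inverse (real (Suc k))))" for p i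
  define P where "P = {p \<in> (UNIV :: nat set) \<times> lists Q. \<exists>i. fits p i}"
  define J where "J = (\<lambda>p. SOME i. fits p i) ` P"
  have fits_J: "fits p (SOME i. fits p i)" if "p \<in> P" for p
    using that unfolding P_def by (auto intro: someI_ex)
  show ?thesis
  proof
    show "J \<subseteq> I"
      using fits_J unfolding J_def fits_def by fastforce
    show "countable J"
      unfolding J_def P_def
      by (intro countable_image countable_Collect countable_SIGMA countable_lists Q) simp
  next
    fix i :: 'i and e :: real assume i: "i \<in> I" and e: "e > 0"
    then obtain k where k: "inverse (real (Suc k)) < e / 2"
      using reals_Archimedean[of "e / 2"] by auto
    define r where "r = inverse (real (Suc k)) / 2"
    have r: "r > 0" by (simp add: r_def)
    have "uniformly_continuous_on {0..1} (u i)"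
      using cont[OF i] by (simp add: compact_uniformly_continuous)
    then obtain d where d: "d > 0"
      "\<And>s t. s \<in> {0..1} \<Longrightarrow> t \<in> {0..1} \<Longrightarrow> dist t s < d \<Longrightarrow> dist (u i t) (u i s) < r"
      using r unfolding uniformly_continuous_on_def by metis
    obtain N where N: "inverse (real (Suc N)) < d" using reals_Archimedean[OF d(1)] by auto
    define n where "n = Suc N"
    have "\<exists>x\<in>Q. x \<in> ball (u i (real m / real n)) r" for m
      using Q(2)[of "ball (u i (real m / real n)) r"] r by auto
    then obtain x where x: "\<And>m. x m \<in> Q" "\<And>m. dist (u i (real m / real n)) (x m) < r"
      by (metis mem_ball)
    define xs where "xs = map x [0..<Suc n]"
    have len: "length xs - 1 = n" by (simp add: xs_def)
    have "fits (k, xs) i"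
      unfolding fits_def prod.case len
    proof (intro conjI ballI i)
      fix t :: real assume t: "t \<in> {0..1}"
      define m where "m = nat \<lfloor>t * real n\<rfloor>"
      have n: "real n > 0" by (simp add: n_def)
      have m: "real m \<le> t * real n" "t * real n < real m + 1"
        using t n by (simp_all add: m_def)
      have "t * real n \<le> real n" using t n by (simp add: mult_left_le_one_le)
      with m(1) have mn: "m \<le> n" by linarith
      have "real m / real n \<le> t" "t < real m / real n + 1 / real n"
        using m n by (simp_all add: field_simps)
      moreover have "1 / real n < d" using N by (simp add: n_def divide_inverse)
      ultimately have "dist t (real m / real n) < d" by (simp add: dist_real_def)
      moreover have "real m / real n \<in> {0..1}" using mn n by simp
      ultimately have "dist (u i t) (u i (real m / real n)) < r" using d(2) t by blast
      then have "dist (u i t) (x m) < r + r"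
        using x(2)[of m] dist_triangle_less_add by (smt (verit) dist_triangle)
      moreover have "xs ! m = x m" using mn by (simp add: xs_def nth_append del: upt_Suc)
      ultimately show "dist (u i t) (xs ! nat \<lfloor>t * real n\<rfloor>) < inverse (real (Suc k))"
        by (simp add: r_def m_def)
    qed
    moreover have "xs \<in> lists Q" using x(1) by (auto simp: xs_def)
    ultimately have p: "(k, xs) \<in> P" unfolding P_def by blast
    define j where "j = (SOME i. fits (k, xs) i)"
    have "fits (k, xs) j" unfolding j_def by (rule fits_J[OF p])
    moreover note \<open>fits (k, xs) i\<close>
    ultimately have "dist (u i t) (u j t) < e" if "t \<in> {0..1}" for t
      using that k dist_triangle2[of "u i t" "u j t" "xs ! nat \<lfloor>t * real (length xs - 1)\<rfloor>"]
      unfolding fits_def by fastforce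
    moreover have "j \<in> J" using p unfolding J_def j_def by blast
    ultimately show "\<exists>j\<in>J. \<forall>t\<in>{0..1}. dist (u i t) (u j t) < e" by blast
  qed
qed

section \<open>The operator family\<close>

lemma ip_norm_cinner: "ip_norm cinner x = norm (x :: 'h::chilbert_space)"
  by (simp add: ip_norm_def cinner_self)

locale operator_family =
  fixes A :: "real \<Rightarrow> ('h::{chilbert_space,second_countable_topology} \<times> 'h) set"
    and D :: "'h set"
    and \<alpha> \<alpha>' \<alpha>'' :: "real \<Rightarrow> real"
  assumes weight_nonneg: "\<forall>t\<in>{0..1}. 0 \<le> \<alpha> t"
    and weight_deriv: "\<forall>t\<in>{0..1}. (\<alpha> has_real_derivative \<alpha>' t) (at t within {0..1})"
    and weight_deriv2: "\<forall>t\<in>{0..1}. (\<alpha>' has_real_derivative \<alpha>'' t) (at t within {0..1})"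
    and weight_deriv2_cont: "continuous_on {0..1} \<alpha>''"
    and weight_zeros: "{t\<in>{0..1}. \<alpha> t = 0} \<in> null_sets lebesgue"
    and closed_densely_defined:
      "\<forall>t\<in>{0..1}. closed_operator UNIV cinner (A t) \<and> densely_defined UNIV cinner (A t)"
    and domain: "\<forall>t\<in>{0..1}. Domain (A t) = D"
    and strongly_C1: "\<forall>f\<in>D. \<exists>x x'. (\<forall>t\<in>{0..1}. (f, x t) \<in> A t \<and>
                                   (x has_vector_derivative x' t) (at t within {0..1})) \<and>
                     continuous_on {0..1} x'"
begin

text \<open>
  \<open>A(t) f\<close> as a function. It is meaningful for \<open>f \<in> D\<close> only; elsewhere it is an arbitrary vector.
\<close>

definition act :: "real \<Rightarrow> 'h \<Rightarrow> 'h" where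
  "act t f = (SOME y. (f, y) \<in> A t)"

definition dact :: "real \<Rightarrow> 'h \<Rightarrow> 'h" where
  "dact t f = vector_derivative (\<lambda>s. act s f) (at t within {0..1})"

lemma linear_A: "t \<in> {0..1} \<Longrightarrow> linear_operator UNIV cinner (A t)"
  using closed_densely_defined by (simp add: closed_operator_def)

lemma graph_iff: "t \<in> {0..1} \<Longrightarrow> (f, y) \<in> A t \<longleftrightarrow> f \<in> D \<and> y = act t f"
proof -
  assume t: "t \<in> {0..1}"
  have unique: "y = z" if "(f, y) \<in> A t" "(f, z) \<in> A t" for f y z
    using linear_A[OF t] that unfolding linear_operator_def ip_norm_cinner by fastforce
  have "(f, act t f) \<in> A t" if "f \<in> D" for f
    using domain t that unfolding act_def by (metis DomainE someI_ex)
  then show ?thesis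
    using unique domain t by blast
qed

lemma graph_act: "t \<in> {0..1} \<Longrightarrow> f \<in> D \<Longrightarrow> (f, act t f) \<in> A t"
  by (simp add: graph_iff)

lemma graph_add:
  "t \<in> {0..1} \<Longrightarrow> f \<in> D \<Longrightarrow> g \<in> D \<Longrightarrow> (f + g, act t f + act t g) \<in> A t"
  using linear_A[of t] graph_act[of t f] graph_act[of t g] unfolding linear_operator_def by blast

lemma graph_scale: "t \<in> {0..1} \<Longrightarrow> f \<in> D \<Longrightarrow> (c *\<^sub>C f, c *\<^sub>C act t f) \<in> A t"
  using linear_A[of t] graph_act[of t f] unfolding linear_operator_def by blast

lemma D_zero: "0 \<in> D"
  using linear_A[of 0] graph_iff[of 0 0 0] unfolding linear_operator_def by simp

lemma D_add: "f \<in> D \<Longrightarrow> g \<in> D \<Longrightarrow> f + g \<in> D"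
  using graph_add[of 0 f g] graph_iff[of 0] by simp

lemma D_scale: "f \<in> D \<Longrightarrow> c *\<^sub>C f \<in> D"
  using graph_scale[of 0 f c] graph_iff[of 0] by simp

lemma D_scaleR: "f \<in> D \<Longrightarrow> r *\<^sub>R f \<in> D"
  using D_scale by (simp add: scaleR_scaleC)

lemma D_diff: "f \<in> D \<Longrightarrow> g \<in> D \<Longrightarrow> f - g \<in> D"
  using D_add[of f "(-1) *\<^sub>R g"] D_scaleR[of g "-1"] by simp

lemma D_dense: "closure D = UNIV"
proof -
  have "v \<in> closure D" for v
    using closed_densely_defined[rule_format, of 0] domain[rule_format, of 0]
    unfolding densely_defined_def ip_norm_cinner
    by (simp add: closure_approachable dist_norm)
  then show ?thesis by blast
qed

lemma act_add: "t \<in> {0..1} \<Longrightarrow> f \<in> D \<Longrightarrow> g \<in> D \<Longrightarrow> act t (f + g) = act t f + act t g"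
  using graph_add[of t f g] by (simp add: graph_iff)

lemma act_scale: "t \<in> {0..1} \<Longrightarrow> f \<in> D \<Longrightarrow> act t (c *\<^sub>C f) = c *\<^sub>C act t f"
  using graph_scale[of t f c] by (simp add: graph_iff)

lemma act_scaleR: "t \<in> {0..1} \<Longrightarrow> f \<in> D \<Longrightarrow> act t (r *\<^sub>R f) = r *\<^sub>R act t f"
  using act_scale by (simp add: scaleR_scaleC)

lemma act_diff: "t \<in> {0..1} \<Longrightarrow> f \<in> D \<Longrightarrow> g \<in> D \<Longrightarrow> act t (f - g) = act t f - act t g"
  using act_add[of t f "(-1) *\<^sub>R g"] act_scaleR[of t g "-1"] D_scaleR[of g "-1"] by simp

lemma
  assumes f: "f \<in> D"
  shows act_deriv_within: "\<And>t. t \<in> {0..1} \<Longrightarrow>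
      ((\<lambda>s. act s f) has_vector_derivative dact t f) (at t within {0..1})"
    and dact_cont: "continuous_on {0..1} (\<lambda>t. dact t f)"
proof -
  obtain x x' where x: "\<forall>t\<in>{0..1}. (f, x t) \<in> A t \<and> (x has_vector_derivative x' t) (at t within {0..1})"
    and x': "continuous_on {0..1} x'"
    using strongly_C1 f by blast
  have xa: "x s = act s f" if "s \<in> {0..1}" for s using x that graph_iff by blast
  have d: "((\<lambda>s. act s f) has_vector_derivative x' s) (at s within {0..1})" if "s \<in> {0..1}" for s
    by (rule has_vector_derivative_transform[OF that _ x[rule_format, OF that, THEN conjunct2]])
      (simp add: xa)
  have a': "dact s f = x' s" if "s \<in> {0..1}" for s
    using vector_derivative_within_cbox[of 0 1 s "\<lambda>s. act s f"] d[OF that] that by (simp add: dact_def)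
  show "((\<lambda>s. act s f) has_vector_derivative dact t f) (at t within {0..1})" if "t \<in> {0..1}" for t
    using d[OF that] by (simp only: a'[OF that])
  show "continuous_on {0..1} (\<lambda>t. dact t f)"
    using x' by (rule continuous_on_eq) (simp add: a')
qed

lemma act_cont: "f \<in> D \<Longrightarrow> continuous_on {0..1} (\<lambda>t. act t f)"
  by (rule continuous_on_vector_derivative[OF act_deriv_within])

lemma act_deriv: "f \<in> D \<Longrightarrow> t \<in> {0<..<1} \<Longrightarrow> ((\<lambda>s. act s f) has_vector_derivative dact t f) (at t)"
  using act_deriv_within[of f t] at_within_Icc_at[of 0 t 1] by simp

lemma dact_add:
  assumes "t \<in> {0<..<1}" "f \<in> D" "g \<in> D"
  shows "dact t (f + g) = dact t f + dact t g"
proof (rule vector_derivative_unique_at)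
  show "((\<lambda>s. act s (f + g)) has_vector_derivative dact t (f + g)) (at t)"
    using assms by (intro act_deriv D_add)
  have "((\<lambda>s. act s f + act s g) has_vector_derivative dact t f + dact t g) (at t)"
    using assms by (intro has_vector_derivative_add act_deriv)
  then show "((\<lambda>s. act s (f + g)) has_vector_derivative dact t f + dact t g) (at t)"
    by (rule has_vector_derivative_transform_within_open[of _ _ _ "{0<..<1}"])
      (use assms act_add in auto)
qed

lemma dact_scale:
  assumes "t \<in> {0<..<1}" "f \<in> D"
  shows "dact t (c *\<^sub>C f) = c *\<^sub>C dact t f"
proof (rule vector_derivative_unique_at)
  show "((\<lambda>s. act s (c *\<^sub>C f)) has_vector_derivative dact t (c *\<^sub>C f)) (at t)"
    using assms by (intro act_deriv D_scale)
  have "((\<lambda>s. c *\<^sub>C act s f) has_vector_derivative c *\<^sub>C dact t f) (at t)"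
    using assms by (intro bounded_linear.has_vector_derivative[OF bounded_linear_scaleC] act_deriv)
  then show "((\<lambda>s. act s (c *\<^sub>C f)) has_vector_derivative c *\<^sub>C dact t f) (at t)"
    by (rule has_vector_derivative_transform_within_open[of _ _ _ "{0<..<1}"])
      (use assms act_scale in auto)
qed

lemma dact_diff:
  assumes "t \<in> {0<..<1}" "f \<in> D" "g \<in> D"
  shows "dact t (f - g) = dact t f - dact t g"
  using dact_add[OF assms(1), of "f - g" g] assms by (simp add: D_diff)

definition positive_times :: "real set" where
  "positive_times = {t \<in> {0<..<1}. 0 < \<alpha> t}"

lemma weight_cont: "continuous_on {0..1} \<alpha>" and weight'_cont: "continuous_on {0..1} \<alpha>'"
  using weight_deriv weight_deriv2 by (meson DERIV_continuous_on)+

lemma positive_times_subset: "positive_times \<subseteq> {0<..<1}" "positive_times \<subseteq> {0..1}"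
  by (auto simp: positive_times_def)

lemma open_positive_times: "open positive_times"
proof -
  have "continuous_on {0<..<1} \<alpha>" using weight_cont by (rule continuous_on_subset) auto
  then have "open ({0<..<1} \<inter> \<alpha> -` {0<..})"
    by (rule continuous_open_preimage) auto
  also have "{0<..<1} \<inter> \<alpha> -` {0<..} = positive_times" by (auto simp: positive_times_def)
  finally show ?thesis .
qed

lemma AE_positive_times: "AE t in lebesgue_on {0<..<1}. t \<in> positive_times"
proof -
  have "AE t in lebesgue_on {0<..<1}. t \<notin> {t\<in>{0..1}. \<alpha> t = 0}"
    using weight_zeros by (intro AE_lebesgue_on_if_AE_lebesgue AE_not_in)
  moreover have "AE t in lebesgue_on {0<..<1}. t \<in> {0<..<1::real}"
    using AE_space[of "lebesgue_on {0<..<1::real}"] by simp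
  ultimately show ?thesis
  proof eventually_elim
    case (elim t)
    then show ?case using weight_nonneg[rule_format, of t] by (simp add: positive_times_def)
  qed
qed

text \<open>
  The sesquilinear form of \<open>C(t) = 2 Re A(t) - (\<alpha>'/\<alpha>) I\<close>. Putting \<open>A(t)\<close> on both sides avoids the
  adjoint, so the form is defined and differentiable on \<open>D\<close> before anything is known about
  \<open>D(A\<^sup>*(t))\<close>.
\<close>

definition shifted_form :: "real \<Rightarrow> 'h \<Rightarrow> 'h \<Rightarrow> complex" where
  "shifted_form t f e = cinner (act t f) e + cinner f (act t e) - (\<alpha>' t / \<alpha> t) *\<^sub>R cinner f e"

definition shifted_form_deriv :: "real \<Rightarrow> 'h \<Rightarrow> 'h \<Rightarrow> complex" where
  "shifted_form_deriv t f e = cinner (dact t f) e + cinner f (dact t e)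
     - ((\<alpha>'' t * \<alpha> t - \<alpha>' t * \<alpha>' t) / (\<alpha> t * \<alpha> t)) *\<^sub>R cinner f e"

lemma weight_deriv_at: "t \<in> {0<..<1} \<Longrightarrow> (\<alpha> has_real_derivative \<alpha>' t) (at t)"
  using weight_deriv[rule_format, of t] at_within_Icc_at[of 0 t 1] by simp

lemma weight_deriv2_at: "t \<in> {0<..<1} \<Longrightarrow> (\<alpha>' has_real_derivative \<alpha>'' t) (at t)"
  using weight_deriv2[rule_format, of t] at_within_Icc_at[of 0 t 1] by simp

lemma shifted_form_has_derivative:
  assumes t: "t \<in> positive_times" and "f \<in> D" "e \<in> D"
  shows "((\<lambda>s. shifted_form s f e) has_vector_derivative shifted_form_deriv t f e) (at t)"
proof -
  have t01: "t \<in> {0<..<1}" and pos: "\<alpha> t \<noteq> 0" using t by (auto simp: positive_times_def)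
  have "((\<lambda>s. \<alpha>' s / \<alpha> s) has_real_derivative (\<alpha>'' t * \<alpha> t - \<alpha>' t * \<alpha>' t) / (\<alpha> t * \<alpha> t)) (at t)"
    by (rule DERIV_divide) (use t01 pos weight_deriv_at weight_deriv2_at in auto)
  then have "((\<lambda>s. (\<alpha>' s / \<alpha> s) *\<^sub>R cinner f e) has_vector_derivative
      ((\<alpha>'' t * \<alpha> t - \<alpha>' t * \<alpha>' t) / (\<alpha> t * \<alpha> t)) *\<^sub>R cinner f e) (at t)"
    using has_vector_derivative_scaleR[of _ _ _ _ "\<lambda>_. cinner f e" 0] by fastforce
  moreover have "((\<lambda>s. cinner (act s f) e) has_vector_derivative cinner (dact t f) e) (at t)"
    by (intro bounded_linear.has_vector_derivative[OF cinner.bounded_linear_left] act_deriv assms t01)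
  moreover have "((\<lambda>s. cinner f (act s e)) has_vector_derivative cinner f (dact t e)) (at t)"
    by (intro bounded_linear.has_vector_derivative[OF cinner.bounded_linear_right] act_deriv assms t01)
  ultimately show ?thesis
    unfolding shifted_form_def shifted_form_deriv_def by (intro has_vector_derivative_diff has_vector_derivative_add)
qed

text \<open>
  The value that \<open>\<parallel>A\<^sup>*(t) f\<parallel>\<^sup>2\<close> must have according to the commutator identity, expressed without the
  adjoint.
\<close>

definition adj_norm_sq :: "real \<Rightarrow> 'h \<Rightarrow> real" where
  "adj_norm_sq t f = (norm (act t f))\<^sup>2 - Re (shifted_form_deriv t f f)"

lemma adj_norm_sq_cont:
  assumes "f \<in> D"
  shows "continuous_on positive_times (\<lambda>t. adj_norm_sq t f)"
proof -
  have "continuous_on positive_times \<alpha>" "continuous_on positive_times \<alpha>'" "continuous_on positive_times \<alpha>''"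
    "continuous_on positive_times (\<lambda>t. act t f)" "continuous_on positive_times (\<lambda>t. dact t f)"
    using weight_cont weight'_cont weight_deriv2_cont act_cont[OF assms] dact_cont[OF assms]
      continuous_on_subset[OF _ positive_times_subset(2)] by auto
  moreover have "\<forall>t\<in>positive_times. \<alpha> t * \<alpha> t \<noteq> 0" by (auto simp: positive_times_def)
  ultimately show ?thesis
    unfolding adj_norm_sq_def shifted_form_deriv_def by (intro continuous_intros cinner.continuous_on)
qed

lemma adj_norm_sq_tendsto:
  assumes "t \<in> positive_times"
    and "(\<lambda>n. f n) \<longlonglongrightarrow> l" "(\<lambda>n. act t (f n)) \<longlonglongrightarrow> act t l" "(\<lambda>n. dact t (f n)) \<longlonglongrightarrow> dact t l"
  shows "(\<lambda>n. adj_norm_sq t (f n)) \<longlonglongrightarrow> adj_norm_sq t l"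
  unfolding adj_norm_sq_def shifted_form_deriv_def by (intro tendsto_intros cinner.tendsto assms)

text \<open>
  One countable set approximates every \<open>f \<in> D\<close> simultaneously in \<open>f\<close>, \<open>A(t) f\<close> and \<open>A'(t) f\<close>, for all
  \<open>t\<close> at once. It replaces statements about all \<open>f \<in> D\<close> by countably many, so that null sets can be united.
\<close>

lemma countable_uniform_core:
  obtains G where "countable G" "G \<subseteq> D" "closure G = UNIV"
    "\<And>f. f \<in> D \<Longrightarrow> \<exists>u. (\<forall>n. u n \<in> G) \<and> u \<longlonglongrightarrow> f \<and>
       (\<forall>t\<in>{0..1}. (\<lambda>n. act t (u n)) \<longlonglongrightarrow> act t f \<and> (\<lambda>n. dact t (u n)) \<longlonglongrightarrow> dact t f)"
proof -
  have cont: "continuous_on {0..1} (\<lambda>t. (f, act t f, dact t f))" if "f \<in> D" for f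
    using that act_cont dact_cont[of f] by (intro continuous_intros) auto
  obtain G where G: "G \<subseteq> D" "countable G"
    "\<And>f e. f \<in> D \<Longrightarrow> e > 0 \<Longrightarrow>
      \<exists>g\<in>G. \<forall>t\<in>{0..1}. dist (f, act t f, dact t f) (g, act t g, dact t g) < e"
    using countable_uniformly_dense_subset[of D "\<lambda>f t. (f, act t f, dact t f)", OF cont] by blast
  have seq: "\<exists>u. (\<forall>n. u n \<in> G) \<and> u \<longlonglongrightarrow> f \<and>
       (\<forall>t\<in>{0..1}. (\<lambda>n. act t (u n)) \<longlonglongrightarrow> act t f \<and> (\<lambda>n. dact t (u n)) \<longlonglongrightarrow> dact t f)"
    if f: "f \<in> D" for f
  proof -
    have "\<forall>n. \<exists>g\<in>G. \<forall>t\<in>{0..1}. dist (f, act t f, dact t f) (g, act t g, dact t g) < inverse (real (Suc n))"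
      using G(3)[OF f] by simp
    then obtain u where u: "\<And>n. u n \<in> G"
      "\<And>n t. t \<in> {0..1} \<Longrightarrow> dist (f, act t f, dact t f) (u n, act t (u n), dact t (u n)) < inverse (real (Suc n))"
      by metis
    have lim: "(\<lambda>n. (u n, act t (u n), dact t (u n))) \<longlonglongrightarrow> (f, act t f, dact t f)" if "t \<in> {0..1}" for t
    proof (rule metric_LIMSEQ_I)
      fix e :: real assume "e > 0"
      then obtain N where N: "inverse (real (Suc N)) < e" using reals_Archimedean by blast
      have "dist (u n, act t (u n), dact t (u n)) (f, act t f, dact t f) < e" if "n \<ge> N" for n
      proof -
        have "inverse (real (Suc n)) \<le> inverse (real (Suc N))"
          using that by (intro le_imp_inverse_le) auto
        then show ?thesis using u(2)[OF \<open>t \<in> {0..1}\<close>, of n] N by (simp only: dist_commute)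
      qed
      then show "\<exists>N. \<forall>n\<ge>N. dist (u n, act t (u n), dact t (u n)) (f, act t f, dact t f) < e" by blast
    qed
    have "u \<longlonglongrightarrow> f" using tendsto_fst[OF lim[of 0]] by simp
    moreover have "(\<lambda>n. act t (u n)) \<longlonglongrightarrow> act t f" "(\<lambda>n. dact t (u n)) \<longlonglongrightarrow> dact t f" if "t \<in> {0..1}" for t
      using tendsto_fst[OF tendsto_snd[OF lim[OF that]]] tendsto_snd[OF tendsto_snd[OF lim[OF that]]]
      by simp_all
    ultimately show ?thesis using u(1) by blast
  qed
  have "D \<subseteq> closure G"
  proof
    fix f assume "f \<in> D"
    then show "f \<in> closure G" using seq[of f] closure_sequential[of f G] by blast
  qed
  then have "closure G = UNIV" using D_dense closure_minimal[OF _ closed_closure] by blast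
  then show ?thesis using that G(1,2) seq by blast
qed

end

section \<open>Test vectors and the adjoint of the minimal operator\<close>

lemma integrable_continuous_01:
  fixes g :: "real \<Rightarrow> 'b::{banach, second_countable_topology}"
  assumes "continuous_on {0..1} g"
  shows "integrable (lebesgue_on {0<..<1}) g"
proof -
  interpret finite_measure "lebesgue_on {0<..<1::real}"
    by (rule finite_measure_lebesgue_on) simp
  have "bounded (g ` {0..1})"
    by (intro compact_imp_bounded compact_continuous_image assms) simp
  then obtain B where B: "\<And>t. t \<in> {0..1} \<Longrightarrow> norm (g t) \<le> B" unfolding bounded_iff by blast
  show ?thesis
  proof (rule integrable_const_bound)
    show "AE t in lebesgue_on {0<..<1}. norm (g t) \<le> B" using B by (intro AE_I2) simp
    show "g \<in> borel_measurable (lebesgue_on {0<..<1})"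
      by (intro continuous_imp_measurable_on_sets_lebesgue continuous_on_subset[OF assms]) auto
  qed
qed

lemma integral_derivative_01:
  fixes F :: "real \<Rightarrow> 'b::euclidean_space"
  assumes d: "\<And>t. t \<in> {0..1} \<Longrightarrow> (F has_vector_derivative F' t) (at t within {0..1})"
    and "continuous_on {0..1} F'" "F 0 = 0" "F 1 = 0"
  shows "(LINT t|lebesgue_on {0<..<1}. F' t) = 0"
proof -
  have "(LINT t|lebesgue_on {0<..<1}. F' t) = integral {0<..<1} F'"
    by (intro lebesgue_integral_eq_integral integrable_continuous_01 assms) simp
  also have "\<dots> = integral {0..1} F'" by (rule integral_open_interval_real[symmetric])
  also have "\<dots> = F 1 - F 0"
    by (intro integral_unique fundamental_theorem_of_calculus d) auto
  finally show ?thesis using assms by simp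
qed

lemma L2w_continuous:
  fixes u :: "real \<Rightarrow> 'h::{chilbert_space,second_countable_topology}"
  assumes "continuous_on {0..1} \<alpha>" "continuous_on {0..1} u"
  shows "u \<in> L2w \<alpha>"
  unfolding L2w_def using assms
  by (intro CollectI conjI integrable_continuous_01 continuous_intros
      borel_measurable_integrable[OF integrable_continuous_01])

lemma L2w_inner_self: "L2w_inner \<alpha> u u = complex_of_real (LINT t|lebesgue_on {0<..<1}. \<alpha> t * (norm (u t))\<^sup>2)"
  by (simp add: L2w_inner_def cinner_self flip: of_real_mult of_real_power) (simp add: mult.commute)

lemma op_closure_superset: "S \<subseteq> V \<times> V \<Longrightarrow> ip 0 0 = 0 \<Longrightarrow> S \<subseteq> op_closure V ip S"
  unfolding op_closure_def ip_norm_def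
proof (intro subsetI, clarify, intro conjI allI impI)
  fix u v and e :: real
  assume S: "S \<subseteq> V \<times> V" and zero: "ip 0 0 = 0" and uv: "(u, v) \<in> S" and e: "0 < e"
  have "sqrt (Re (ip (u - u) (u - u))) < e \<and> sqrt (Re (ip (v - v) (v - v))) < e"
    using zero e by simp
  then show "\<exists>(u', v')\<in>S. sqrt (Re (ip (u' - u) (u' - u))) < e \<and> sqrt (Re (ip (v' - v) (v' - v))) < e"
    using uv by blast
qed auto

lemma cinner_measurable:
  fixes u v :: "'x \<Rightarrow> 'h::{chilbert_space,second_countable_topology}"
  assumes "u \<in> borel_measurable M" "v \<in> borel_measurable M"
  shows "(\<lambda>x. cinner (u x) (v x)) \<in> borel_measurable M"
  using assms by (rule borel_measurable_continuous_Pair)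
    (intro cinner.continuous_on continuous_intros)

locale formally_normal_family = operator_family A D \<alpha> \<alpha>' \<alpha>''
  for A :: "real \<Rightarrow> ('h::{chilbert_space,second_countable_topology} \<times> 'h) set"
    and D \<alpha> \<alpha>' \<alpha>'' +
  assumes formally_normal: "formally_normal (L2w \<alpha>) (L2w_inner \<alpha>) (minimal_operator \<alpha> D A)"
begin

abbreviation "M \<equiv> lebesgue_on {0<..<1::real}"

lemma test_in_minimal_operator:
  assumes test: "real_test \<phi>" "real_test \<phi>'" and d: "\<And>t. (\<phi> has_real_derivative \<phi>' t) (at t)"
    and f: "f \<in> D"
  shows "(\<lambda>t. \<phi> t *\<^sub>R f, \<lambda>t. \<phi>' t *\<^sub>R f + \<phi> t *\<^sub>R act t f) \<in> minimal_operator \<alpha> D A"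
proof -
  have D0: "(\<lambda>t. \<phi> t *\<^sub>R f) \<in> D0 D"
    unfolding D0_def using real_test_imp_test_function[OF test(1)] f
    by (intro CollectI exI[of _ 1] exI[of _ "\<lambda>_ t. complex_of_real (\<phi> t)"] exI[of _ "\<lambda>_. f"])
      (simp add: scaleC_of_real)
  have graph: "\<exists>w. (\<phi> t *\<^sub>R f, w) \<in> A t \<and>
      \<phi>' t *\<^sub>R f + \<phi> t *\<^sub>R act t f = vector_derivative (\<lambda>t. \<phi> t *\<^sub>R f) (at t) + w"
    if t: "t \<in> {0<..<1}" for t
  proof (intro exI conjI)
    show "(\<phi> t *\<^sub>R f, \<phi> t *\<^sub>R act t f) \<in> A t"
      using graph_scale[of t f "complex_of_real (\<phi> t)"] t f by (simp add: scaleC_of_real)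
    have "((\<lambda>t. \<phi> t *\<^sub>R f) has_vector_derivative \<phi>' t *\<^sub>R f) (at t)"
      using has_vector_derivative_scaleR[OF d has_vector_derivative_const, of f] by simp
    then show "\<phi>' t *\<^sub>R f + \<phi> t *\<^sub>R act t f = vector_derivative (\<lambda>t. \<phi> t *\<^sub>R f) (at t) + \<phi> t *\<^sub>R act t f"
      by (simp add: vector_derivative_at)
  qed
  have "(\<lambda>t. \<phi> t *\<^sub>R f) \<in> L2w \<alpha>" "(\<lambda>t. \<phi>' t *\<^sub>R f + \<phi> t *\<^sub>R act t f) \<in> L2w \<alpha>"
    by (intro L2w_continuous weight_cont continuous_intros real_test_continuous test act_cont f)+
  then have "(\<lambda>t. \<phi> t *\<^sub>R f, \<lambda>t. \<phi>' t *\<^sub>R f + \<phi> t *\<^sub>R act t f) \<in> pre_minimal_operator \<alpha> D A"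
    unfolding pre_minimal_operator_def using D0 graph by blast
  moreover have "L2w_inner \<alpha> 0 0 = (0::complex)"
    unfolding L2w_inner_self by simp
  moreover have "pre_minimal_operator \<alpha> D A \<subseteq> L2w \<alpha> \<times> L2w \<alpha>"
    unfolding pre_minimal_operator_def by blast
  ultimately show ?thesis
    unfolding minimal_operator_def using op_closure_superset by blast
qed

text \<open>
  This is the only place where formal normality enters: \<open>\<phi> f\<close> lies in the domain of the adjoint, and
  its two images have equal norms.
\<close>

lemma adjoint_of_test:
  assumes test: "real_test \<phi>" "real_test \<phi>'" and d: "\<And>t. (\<phi> has_real_derivative \<phi>' t) (at t)"
    and f: "f \<in> D"
  obtains w where "w \<in> L2w \<alpha>"
    "(\<lambda>t. \<phi> t *\<^sub>R f, w) \<in> op_adjoint (L2w \<alpha>) (L2w_inner \<alpha>) (minimal_operator \<alpha> D A)"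
    "(LINT t|M. \<alpha> t * (norm (\<phi>' t *\<^sub>R f + \<phi> t *\<^sub>R act t f))\<^sup>2) = (LINT t|M. \<alpha> t * (norm (w t))\<^sup>2)"
proof -
  let ?v = "\<lambda>t. \<phi>' t *\<^sub>R f + \<phi> t *\<^sub>R act t f"
  note mem = test_in_minimal_operator[OF assms]
  then obtain w where w: "(\<lambda>t. \<phi> t *\<^sub>R f, w) \<in> op_adjoint (L2w \<alpha>) (L2w_inner \<alpha>) (minimal_operator \<alpha> D A)"
    using formally_normal unfolding formally_normal_def by blast
  then have "ip_norm (L2w_inner \<alpha>) ?v = ip_norm (L2w_inner \<alpha>) w"
    using formally_normal mem unfolding formally_normal_def by blast
  then have "(LINT t|M. \<alpha> t * (norm (?v t))\<^sup>2) = (LINT t|M. \<alpha> t * (norm (w t))\<^sup>2)"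
    unfolding ip_norm_def L2w_inner_self by simp
  moreover have "w \<in> L2w \<alpha>" using w unfolding op_adjoint_def by blast
  ultimately show ?thesis using that w by blast
qed

text \<open>
  Because \<open>s \<le> 1 + s\<^sup>2\<close>, the product \<open>\<alpha> \<parallel>w\<parallel>\<close> is dominated by \<open>\<alpha> + \<alpha> \<parallel>w\<parallel>\<^sup>2\<close>.
\<close>

lemma L2w_weighted_integrable:
  fixes w :: "real \<Rightarrow> 'h" and g :: 'h
  assumes "w \<in> L2w \<alpha>"
  shows "integrable M (\<lambda>t. cinner g (w t) * complex_of_real (\<alpha> t))"
proof (rule Bochner_Integration.integrable_bound)
  have "integrable M \<alpha>" by (intro integrable_continuous_01 weight_cont)
  then show "integrable M (\<lambda>t. norm g * (\<alpha> t + \<alpha> t * (norm (w t))\<^sup>2))"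
    using assms unfolding L2w_def by auto
  have "\<alpha> \<in> borel_measurable M" using \<open>integrable M \<alpha>\<close> by simp
  then show "(\<lambda>t. cinner g (w t) * complex_of_real (\<alpha> t)) \<in> borel_measurable M"
    using assms cinner_measurable[OF borel_measurable_const, of w M g] unfolding L2w_def
    by (intro borel_measurable_times) auto
  show "AE t in M. norm (cinner g (w t) * complex_of_real (\<alpha> t))
      \<le> norm (norm g * (\<alpha> t + \<alpha> t * (norm (w t))\<^sup>2))"
  proof (rule AE_I2)
    fix t assume "t \<in> space M"
    then have pos: "0 \<le> \<alpha> t" using weight_nonneg by simp
    have "2 * norm (w t) \<le> 1 + (norm (w t))\<^sup>2"
      using zero_le_power2[of "norm (w t) - 1"] by (simp add: power2_eq_square algebra_simps)
    then have le: "norm (w t) \<le> 1 + (norm (w t))\<^sup>2"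
      using norm_ge_zero[of "w t"] by linarith
    have "norm (cinner g (w t) * complex_of_real (\<alpha> t)) \<le> (norm g * norm (w t)) * \<alpha> t"
      using pos cinner_Cauchy_Schwarz[of g "w t"] by (simp add: norm_mult mult_right_mono)
    also have "\<dots> \<le> (norm g * (1 + (norm (w t))\<^sup>2)) * \<alpha> t"
      using pos le by (intro mult_right_mono mult_left_mono) auto
    also have "\<dots> = norm g * (\<alpha> t + \<alpha> t * (norm (w t))\<^sup>2)" by (simp add: algebra_simps)
    finally show "norm (cinner g (w t) * complex_of_real (\<alpha> t))
      \<le> norm (norm g * (\<alpha> t + \<alpha> t * (norm (w t))\<^sup>2))"
      by simp
  qed
qed

text \<open>
  Pairing \<open>w = L\<^sub>0\<^sup>*(\<phi> f)\<close> with the vectors \<open>\<psi>\<^sup>2 g\<close> and moving the derivative of \<open>\<psi>\<^sup>2\<close> onto \<open>\<alpha> \<phi>\<close> identifies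
  \<open>w\<close> weakly. The null set depends on \<open>g\<close>.
\<close>

lemma adjoint_weak_form:
  assumes test: "real_test \<phi>" "real_test \<phi>'" and d: "\<And>t. (\<phi> has_real_derivative \<phi>' t) (at t)"
    and f: "f \<in> D" and g: "g \<in> D"
    and w: "w \<in> L2w \<alpha>"
      "(\<lambda>t. \<phi> t *\<^sub>R f, w) \<in> op_adjoint (L2w \<alpha>) (L2w_inner \<alpha>) (minimal_operator \<alpha> D A)"
  shows "AE t in M. \<alpha> t *\<^sub>R cinner g (w t)
      = (\<alpha> t * \<phi> t) *\<^sub>R cinner (act t g) f - (\<alpha>' t * \<phi> t + \<phi>' t * \<alpha> t) *\<^sub>R cinner g f"
proof -
  define B where "B t = (\<alpha> t * \<phi> t) *\<^sub>R cinner (act t g) f - (\<alpha>' t * \<phi> t + \<phi>' t * \<alpha> t) *\<^sub>R cinner g f" for t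
  define W where "W t = cinner g (w t) * complex_of_real (\<alpha> t)" for t
  have cont: "continuous_on {0..1} \<phi>" "continuous_on {0..1} \<phi>'"
    by (intro real_test_continuous test)+
  have B_cont: "continuous_on {0..1} B"
    unfolding B_def
    by (intro continuous_intros cinner.continuous_on weight_cont weight'_cont act_cont g cont)
  have int: "integrable M (\<lambda>t. W t - B t)"
    unfolding W_def
    by (intro Bochner_Integration.integrable_diff L2w_weighted_integrable w integrable_continuous_01 B_cont)
  have "AE t in M. W t - B t = 0"
  proof (rule AE_zero_if_test_integrals_zero[OF int])
    fix \<psi> assume psi: "real_test \<psi>"
    \<comment> \<open>\<open>p g\<close> is the vector that is paired with \<open>w\<close>\<close>
    define p where "p t = \<psi> t * \<psi> t" for t
    have p: "real_test p" unfolding p_def by (intro real_test_mult psi)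
    obtain p' where p': "real_test p'" "\<And>t. (p has_real_derivative p' t) (at t)"
      using real_test_derivative[OF p] by blast
    have pc: "continuous_on {0..1} p" "continuous_on {0..1} p'"
      by (intro real_test_continuous p p')+
    have "(\<lambda>t. p t *\<^sub>R g, \<lambda>t. p' t *\<^sub>R g + p t *\<^sub>R act t g) \<in> minimal_operator \<alpha> D A"
      by (rule test_in_minimal_operator[OF p p' g])
    then have weak: "L2w_inner \<alpha> (\<lambda>t. p' t *\<^sub>R g + p t *\<^sub>R act t g) (\<lambda>t. \<phi> t *\<^sub>R f)
        = L2w_inner \<alpha> (\<lambda>t. p t *\<^sub>R g) w"
      using w(2) unfolding op_adjoint_def by blast
    define Z where "Z t = cinner (p' t *\<^sub>R g + p t *\<^sub>R act t g) (\<phi> t *\<^sub>R f) * complex_of_real (\<alpha> t)" for t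
    define Y where "Y t = cinner (p t *\<^sub>R g) (w t) * complex_of_real (\<alpha> t)" for t
    define R where "R t = (p' t * (\<alpha> t * \<phi> t) + (\<alpha>' t * \<phi> t + \<phi>' t * \<alpha> t) * p t) *\<^sub>R cinner g f" for t
    have Z: "integrable M Z"
      unfolding Z_def
      by (intro integrable_continuous_01 continuous_intros cinner.continuous_on weight_cont act_cont g cont pc)
    have R_cont: "continuous_on {0..1} R"
      unfolding R_def
      by (intro continuous_intros weight_cont weight'_cont cont pc)
    have Y: "integrable M Y"
    proof -
      have "bounded (p ` {0..1})"
        by (intro compact_imp_bounded compact_continuous_image pc) simp
      then obtain b where b: "\<And>t. t \<in> {0..1} \<Longrightarrow> norm (p t) \<le> b" unfolding bounded_iff by blast
      have Y_eq: "Y t = p t *\<^sub>R W t" for t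
        by (simp add: Y_def W_def cinner_scaleR_left)
      have W: "integrable M W" unfolding W_def by (rule L2w_weighted_integrable[OF w(1)])
      have "integrable M (\<lambda>t. b *\<^sub>R norm (W t))" using W by simp
      then show ?thesis
      proof (rule Bochner_Integration.integrable_bound)
        show "Y \<in> borel_measurable M"
          unfolding Y_eq[abs_def] using W integrable_continuous_01[OF pc(1)] by simp
        show "AE t in M. norm (Y t) \<le> norm (b *\<^sub>R norm (W t))"
        proof (rule AE_I2)
          fix t assume "t \<in> space M"
          then have "\<bar>p t\<bar> \<le> \<bar>b\<bar>" using b[of t] by auto
          then show "norm (Y t) \<le> norm (b *\<^sub>R norm (W t))"
            by (simp add: Y_eq abs_mult mult_right_mono)
        qed
      qed
    qed
    have "((\<lambda>t. (p t * (\<alpha> t * \<phi> t)) *\<^sub>R cinner g f) has_vector_derivative R t) (at t within {0..1})"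
      if "t \<in> {0..1}" for t
    proof -
      have "((\<lambda>t. p t * (\<alpha> t * \<phi> t)) has_real_derivative
          p' t * (\<alpha> t * \<phi> t) + (\<alpha>' t * \<phi> t + \<phi>' t * \<alpha> t) * p t) (at t within {0..1})"
        using that weight_deriv
        by (intro DERIV_mult has_field_derivative_at_within[OF p'(2)] has_field_derivative_at_within[OF d]) auto
      from has_vector_derivative_scaleR[OF this has_vector_derivative_const, of "cinner g f"] show ?thesis
        by (simp add: R_def)
    qed
    then have "(LINT t|M. R t) = 0"
      using R_cont real_test_outside[OF p, of 0] real_test_outside[OF p, of 1]
      by (intro integral_derivative_01[of "\<lambda>t. (p t * (\<alpha> t * \<phi> t)) *\<^sub>R cinner g f"]) auto
    moreover have "(\<psi> t)\<^sup>2 *\<^sub>R (W t - B t) = Y t - Z t + R t" for t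
      by (simp add: Y_def Z_def R_def W_def B_def p_def cinner_add_left cinner_scaleR_left
          cinner_scaleR_right scaleR_conv_of_real power2_eq_square algebra_simps)
    moreover have "(LINT t|M. Z t) = (LINT t|M. Y t)"
      using weak unfolding L2w_inner_def Z_def Y_def .
    ultimately show "(LINT t|M. (\<psi> t)\<^sup>2 *\<^sub>R (W t - B t)) = 0"
      using Y Z integrable_continuous_01[OF R_cont] by simp
  qed
  then show ?thesis
    by eventually_elim (simp add: W_def B_def scaleR_conv_of_real mult.commute)
qed

end

section \<open>The norm identity for a single vector\<close>

text \<open>
  The integrand of the energy balance at a fixed time, with \<open>af\<close>, \<open>Y\<close> and \<open>a'f\<close> in the places of
  \<open>A f\<close>, \<open>A\<^sup>* f\<close> and \<open>A' f\<close>. The bracket subtracted on the left is the derivative of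
  \<open>p\<^sup>2 (2 \<alpha> Re \<langle>A f, f\<rangle> - \<alpha>' \<parallel>f\<parallel>\<^sup>2)\<close>, so it integrates to zero. The vectors \<open>A f\<close> and \<open>A\<^sup>* f\<close> have the
  same real inner product with \<open>f\<close>, but this is available only where \<open>p\<close> does not vanish.
\<close>

lemma energy_identity:
  fixes f Y :: "'h::chilbert_space"
  assumes "al > 0" and w: "w = p *\<^sub>R Y - (p' + p * al' / al) *\<^sub>R f"
    and rho: "p \<noteq> 0 \<Longrightarrow> Re (cinner af f) = Re (cinner Y f)"
    and qq: "qq = 2 * Re (cinner a'f f) - ((al'' * al - al' * al') / (al * al)) * (norm f)\<^sup>2"
  shows "al * (norm (p' *\<^sub>R f + p *\<^sub>R af))\<^sup>2 - al * (norm w)\<^sup>2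
      - (2 * p * p' * (2 * al * Re (cinner af f) - al' * (norm f)\<^sup>2)
         + p\<^sup>2 * (2 * al' * Re (cinner af f) + 2 * al * Re (cinner a'f f) - al'' * (norm f)\<^sup>2))
      = p\<^sup>2 * (al * ((norm af)\<^sup>2 - qq - (norm Y)\<^sup>2))"
proof -
  define r where "r = Re (cinner af f)"
  define x where "x = Re (cinner Y f)"
  have pr: "p * r = p * x" using rho by (cases "p = 0") (auto simp: r_def x_def)
  have 1: "(norm (p' *\<^sub>R f + p *\<^sub>R af))\<^sup>2 = p'\<^sup>2 * (norm f)\<^sup>2 + 2 * (p' * p * r) + p\<^sup>2 * (norm af)\<^sup>2"
    using Re_cinner_commute[of f af]
    by (simp add: norm_add_sq cinner_scaleR_left cinner_scaleR_right power_mult_distrib r_def)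
  define k where "k = p' + p * al' / al"
  have wk: "w = p *\<^sub>R Y + (- k) *\<^sub>R f" by (simp only: w k_def[symmetric]) simp
  have 2: "(norm w)\<^sup>2 = p\<^sup>2 * (norm Y)\<^sup>2 - 2 * (p * k * x) + k\<^sup>2 * (norm f)\<^sup>2"
    using norm_add_sq[of "p *\<^sub>R Y" "(- k) *\<^sub>R f"]
    by (simp only: wk[symmetric]) (simp add: cinner_scaleR_left cinner_scaleR_right cinner.minus_right
        power_mult_distrib x_def)
  have 3: "al * k = al * p' + p * al'" using assms(1) by (simp add: k_def field_simps)
  have 4: "al * k\<^sup>2 = al * p'\<^sup>2 + 2 * p * p' * al' + p\<^sup>2 * (al' * al' / al)"
    using assms(1) by (simp add: k_def field_simps power2_eq_square)
  have 5: "al * (norm w)\<^sup>2 = al * p\<^sup>2 * (norm Y)\<^sup>2 - 2 * (al * p' + p * al') * (p * r)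
      + (al * p'\<^sup>2 + 2 * p * p' * al' + p\<^sup>2 * (al' * al' / al)) * (norm f)\<^sup>2"
    unfolding 2 3[symmetric] 4[symmetric] pr by (simp add: algebra_simps)
  have 6: "al * qq = 2 * al * Re (cinner a'f f) - al'' * (norm f)\<^sup>2 + (al' * al' / al) * (norm f)\<^sup>2"
    using assms(1) by (simp add: qq field_simps power2_eq_square)
  have "p\<^sup>2 * (al * ((norm af)\<^sup>2 - qq - (norm Y)\<^sup>2))
      = p\<^sup>2 * (al * (norm af)\<^sup>2 - al * qq - al * (norm Y)\<^sup>2)" by (simp add: algebra_simps)
  then show ?thesis
    unfolding 1 5 6 r_def[symmetric] by (simp add: algebra_simps power2_eq_square)
qed

context formally_normal_family
begin

text \<open>
  The candidate \<open>Y t\<close> for \<open>A\<^sup>*(t) f\<close> is chosen for each \<open>t\<close> separately, as a vector that represents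
  \<open>g \<mapsto> \<langle>A(t) g, f\<rangle>\<close> on the dense set \<open>G\<close>. For every test function \<open>\<phi>\<close> the measurable function
  \<open>L\<^sub>0\<^sup>*(\<phi> f)\<close> agrees almost everywhere with its expression in \<open>Y\<close>, so \<open>Y\<close> is independent of \<open>\<phi>\<close>, and the
  energy balance can be localised.
\<close>

lemma adjoint_pointwise:
  assumes f: "f \<in> D" and G: "countable G" "G \<subseteq> D" "closure G = UNIV" "f \<in> G"
  obtains Y where
    "AE t in M. (\<forall>g\<in>G. cinner (act t g) f = cinner g (Y t)) \<and> (norm (Y t))\<^sup>2 = adj_norm_sq t f"
proof -
  define spec where "spec t z \<longleftrightarrow> (\<forall>g\<in>G. cinner (act t g) f = cinner g z)" for t z
  define Y where "Y t = (SOME z. spec t z)" for t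
  have local: "AE t in M. (\<phi> t \<noteq> 0 \<longrightarrow> spec t (Y t)) \<and>
      w t = \<phi> t *\<^sub>R Y t - (\<phi>' t + \<phi> t * \<alpha>' t / \<alpha> t) *\<^sub>R f"
    if test: "real_test \<phi>" "real_test \<phi>'" and d: "\<And>t. (\<phi> has_real_derivative \<phi>' t) (at t)"
    and w: "w \<in> L2w \<alpha>"
      "(\<lambda>t. \<phi> t *\<^sub>R f, w) \<in> op_adjoint (L2w \<alpha>) (L2w_inner \<alpha>) (minimal_operator \<alpha> D A)"
    for \<phi> \<phi>' w
  proof -
    have "AE t in M. \<forall>g\<in>G. \<alpha> t *\<^sub>R cinner g (w t)
      = (\<alpha> t * \<phi> t) *\<^sub>R cinner (act t g) f - (\<alpha>' t * \<phi> t + \<phi>' t * \<alpha> t) *\<^sub>R cinner g f"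
      by (rule AE_ball_countable'[OF _ G(1)]) (use adjoint_weak_form[OF test d f _ w] G(2) in blast)
    then show ?thesis using AE_positive_times
    proof eventually_elim
      case (elim t)
      have al: "\<alpha> t > 0" using elim(2) by (simp add: positive_times_def)
      define k where "k = \<phi>' t + \<phi> t * \<alpha>' t / \<alpha> t"
      have w_eq: "cinner g (w t + k *\<^sub>R f) = \<phi> t *\<^sub>R cinner (act t g) f" if "g \<in> G" for g
      proof -
        have "\<alpha> t *\<^sub>R cinner g (w t + k *\<^sub>R f)
            = (\<alpha> t * \<phi> t) *\<^sub>R cinner (act t g) f - (\<alpha>' t * \<phi> t + \<phi>' t * \<alpha> t) *\<^sub>R cinner g f
              + (\<alpha> t * k) *\<^sub>R cinner g f"
          using elim(1) that by (simp add: cinner_add_right cinner_scaleR_right scaleR_add_right)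
        also have "\<alpha> t * k = \<alpha>' t * \<phi> t + \<phi>' t * \<alpha> t" using al by (simp add: k_def field_simps)
        finally have "\<alpha> t *\<^sub>R cinner g (w t + k *\<^sub>R f) = \<alpha> t *\<^sub>R (\<phi> t *\<^sub>R cinner (act t g) f)" by simp
        then show ?thesis using al unfolding scaleR_cancel_left by simp
      qed
      have Y: "spec t (Y t)" if "\<phi> t \<noteq> 0"
      proof -
        have "spec t ((1 / \<phi> t) *\<^sub>R (w t + k *\<^sub>R f))"
          unfolding spec_def using w_eq that by (simp add: cinner_scaleR_right)
        then show ?thesis unfolding Y_def by (rule someI)
      qed
      have "w t + k *\<^sub>R f = \<phi> t *\<^sub>R Y t"
      proof (rule eq_if_cinner_eq_on_dense[OF G(3)])
        fix g assume g: "g \<in> G"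
        have "cinner g (w t + k *\<^sub>R f) = cinner g (\<phi> t *\<^sub>R Y t)"
          using w_eq[OF g] Y g by (cases "\<phi> t = 0") (auto simp: spec_def cinner_scaleR_right cinner.zero_right)
        then show "cinner (w t + k *\<^sub>R f) g = cinner (\<phi> t *\<^sub>R Y t) g"
          by (metis cinner_commute)
      qed
      then show ?case using Y by (simp add: k_def eq_diff_eq)
    qed
  qed
  define rho where "rho t = Re (cinner (act t f) f)" for t
  \<comment> \<open>\<open>m = \<alpha> \<langle>C f, f\<rangle>\<close>, cleared of the division by \<open>\<alpha>\<close> and therefore of class C1 on all of \<open>[0,1]\<close>\<close>
  define m where "m t = 2 * \<alpha> t * rho t - \<alpha>' t * (norm f)\<^sup>2" for t
  define m' where "m' t = 2 * \<alpha>' t * rho t + 2 * \<alpha> t * Re (cinner (dact t f) f) - \<alpha>'' t * (norm f)\<^sup>2" for t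
  have m_deriv: "(m has_real_derivative m' t) (at t within {0..1})" if t: "t \<in> {0..1}" for t
  proof -
    have "((\<lambda>s. cinner (act s f) f) has_vector_derivative cinner (dact t f) f) (at t within {0..1})"
      by (intro bounded_linear.has_vector_derivative[OF cinner.bounded_linear_left] act_deriv_within f t)
    then have "(rho has_real_derivative Re (cinner (dact t f) f)) (at t within {0..1})"
      unfolding rho_def has_real_derivative_iff_has_vector_derivative
      by (rule bounded_linear.has_vector_derivative[OF bounded_linear_Re])
    then show ?thesis
      unfolding m_def m'_def using weight_deriv[rule_format, OF t] weight_deriv2[rule_format, OF t]
      by (auto intro!: derivative_eq_intros)
  qed
  have m_cont: "continuous_on {0..1} m" "continuous_on {0..1} m'"
    unfolding m_def m'_def rho_def
    by (intro continuous_intros cinner.continuous_on weight_cont weight'_cont weight_deriv2_cont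
        act_cont dact_cont f)+
  have level: "AE t in M. \<theta> t \<noteq> 0 \<longrightarrow> spec t (Y t) \<and> (norm (Y t))\<^sup>2 = adj_norm_sq t f"
    if theta: "real_test \<theta>" for \<theta>
  proof -
    define E where "E t = \<alpha> t * (adj_norm_sq t f - (norm (Y t))\<^sup>2)" for t
    \<comment> \<open>the function \<open>\<phi>\<^sup>2 E\<close> is replaced by an almost everywhere equal \<open>k\<close> that is visibly measurable\<close>
    have key: "\<exists>k. integrable M k \<and> (LINT t|M. k t) = 0 \<and> (AE t in M. k t = (\<phi> t)\<^sup>2 * E t)"
      if phi: "real_test \<phi>" for \<phi>
    proof -
      obtain \<phi>' where phi': "real_test \<phi>'" "\<And>t. (\<phi> has_real_derivative \<phi>' t) (at t)"
        using real_test_derivative[OF phi] by blast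
      obtain w where w: "w \<in> L2w \<alpha>"
          "(\<lambda>t. \<phi> t *\<^sub>R f, w) \<in> op_adjoint (L2w \<alpha>) (L2w_inner \<alpha>) (minimal_operator \<alpha> D A)"
        and eq: "(LINT t|M. \<alpha> t * (norm (\<phi>' t *\<^sub>R f + \<phi> t *\<^sub>R act t f))\<^sup>2) = (LINT t|M. \<alpha> t * (norm (w t))\<^sup>2)"
        using adjoint_of_test[OF phi phi' f] by blast
      define V where "V t = \<alpha> t * (norm (\<phi>' t *\<^sub>R f + \<phi> t *\<^sub>R act t f))\<^sup>2" for t
      define W where "W t = \<alpha> t * (norm (w t))\<^sup>2" for t
      define R where "R t = 2 * \<phi> t * \<phi>' t * m t + (\<phi> t)\<^sup>2 * m' t" for t
      have cont: "continuous_on {0..1} \<phi>" "continuous_on {0..1} \<phi>'"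
        by (intro real_test_continuous phi phi')+
      have V: "integrable M V"
        unfolding V_def by (intro integrable_continuous_01 continuous_intros weight_cont cont act_cont f)
      have W: "integrable M W" using w(1) unfolding L2w_def W_def by blast
      have R_cont: "continuous_on {0..1} R"
        unfolding R_def by (intro continuous_intros cont m_cont)
      then have R: "integrable M R" by (rule integrable_continuous_01)
      have "((\<lambda>t. (\<phi> t)\<^sup>2 * m t) has_vector_derivative R t) (at t within {0..1})" if "t \<in> {0..1}" for t
        unfolding has_real_derivative_iff_has_vector_derivative[symmetric] R_def
        using has_field_derivative_at_within[OF phi'(2)] m_deriv[OF that]
        by (auto intro!: derivative_eq_intros)
      then have "(LINT t|M. R t) = 0"
        using R_cont real_test_outside[OF phi, of 0] real_test_outside[OF phi, of 1]
        by (intro integral_derivative_01[of "\<lambda>t. (\<phi> t)\<^sup>2 * m t"]) auto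
      moreover have "(LINT t|M. V t) = (LINT t|M. W t)" using eq unfolding V_def W_def .
      ultimately have "(LINT t|M. V t - W t - R t) = 0" using V W R by simp
      moreover have "integrable M (\<lambda>t. V t - W t - R t)" using V W R by simp
      moreover have "AE t in M. V t - W t - R t = (\<phi> t)\<^sup>2 * E t"
        using local[OF phi phi' w] AE_positive_times
      proof eventually_elim
        case (elim t)
        have al: "\<alpha> t > 0" using elim(2) by (simp add: positive_times_def)
        have rho: "Re (cinner (act t f) f) = Re (cinner (Y t) f)" if "\<phi> t \<noteq> 0"
          using elim(1) that G(4) Re_cinner_commute[of f "Y t"] by (auto simp: spec_def)
        have "Re (shifted_form_deriv t f f) = 2 * Re (cinner (dact t f) f)
            - ((\<alpha>'' t * \<alpha> t - \<alpha>' t * \<alpha>' t) / (\<alpha> t * \<alpha> t)) * (norm f)\<^sup>2"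
          using Re_cinner_commute[of f "dact t f"] by (simp add: shifted_form_deriv_def norm_eq_Re_cinner)
        from energy_identity[OF al elim(1)[THEN conjunct2] rho this]
        show ?case
          by (simp add: V_def W_def R_def E_def adj_norm_sq_def m_def m'_def rho_def)
      qed
      ultimately show ?thesis by blast
    qed
    \<comment> \<open>nothing bounds \<open>E\<close> near the ends of \<open>(0,1)\<close>; the cutoff \<open>\<theta>\<^sup>2\<close> makes it integrable, and \<open>\<psi> \<theta>\<close> is again a test function\<close>
    obtain k where k: "integrable M k" "AE t in M. k t = (\<theta> t)\<^sup>2 * E t"
      using key[OF theta] by blast
    have k0: "AE t in M. k t = 0"
    proof (rule AE_zero_if_test_integrals_zero[OF k(1)])
      fix \<psi> assume psi: "real_test \<psi>"
      obtain k' where k': "integrable M k'" "(LINT t|M. k' t) = 0"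
        "AE t in M. k' t = (\<psi> t * \<theta> t)\<^sup>2 * E t"
        using key[OF real_test_mult[OF psi theta]] by blast
      have "AE t in M. (\<psi> t)\<^sup>2 *\<^sub>R k t = k' t"
        using k(2) k'(3) by eventually_elim (simp add: power_mult_distrib)
      moreover have "\<psi> \<in> borel_measurable M"
        using integrable_continuous_01[OF real_test_continuous[OF psi]] by simp
      ultimately have "(LINT t|M. (\<psi> t)\<^sup>2 *\<^sub>R k t) = (LINT t|M. k' t)"
        using k(1) k'(1) by (intro integral_cong_AE) auto
      then show "(LINT t|M. (\<psi> t)\<^sup>2 *\<^sub>R k t) = 0" using k'(2) by simp
    qed
    obtain \<theta>' where theta': "real_test \<theta>'" "\<And>t. (\<theta> has_real_derivative \<theta>' t) (at t)"
      using real_test_derivative[OF theta] by blast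
    obtain w where w: "w \<in> L2w \<alpha>"
          "(\<lambda>t. \<theta> t *\<^sub>R f, w) \<in> op_adjoint (L2w \<alpha>) (L2w_inner \<alpha>) (minimal_operator \<alpha> D A)"
      using adjoint_of_test[OF theta theta' f] by blast
    show ?thesis
      using k0 k(2) local[OF theta theta' w] AE_positive_times
      by eventually_elim (auto simp: E_def positive_times_def)
  qed
  \<comment> \<open>the bumps exhaust \<open>(0,1)\<close>\<close>
  have "AE t in M. \<forall>n. bump 0 1 n t \<noteq> 0 \<longrightarrow> spec t (Y t) \<and> (norm (Y t))\<^sup>2 = adj_norm_sq t f"
    unfolding AE_all_countable by (intro allI level real_test_bump) auto
  then have "AE t in M. spec t (Y t) \<and> (norm (Y t))\<^sup>2 = adj_norm_sq t f"
    using AE_positive_times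
  proof eventually_elim
    case (elim t)
    have "(\<lambda>n. bump 0 1 n t) \<longlonglongrightarrow> 1"
      using bump_tendsto_indicator[of 0 1 t] elim(2) by (simp add: positive_times_def)
    moreover have "\<not> (\<lambda>n. 0 :: real) \<longlonglongrightarrow> 1" by (simp add: LIMSEQ_const_iff)
    ultimately obtain n where "bump 0 1 n t \<noteq> 0" by (metis ext)
    then show ?case using elim(1) by blast
  qed
  then show ?thesis using that unfolding spec_def by blast
qed

end

section \<open>The adjoints at every time and the commutator\<close>

text \<open>
  Polarisation: replacing \<open>g\<close> by \<open>\<i> g\<close> separates \<open>B f g\<close> from \<open>B g f\<close>.
\<close>

lemma sesquilinear_eq_zero:
  fixes B :: "'h::chilbert_space \<Rightarrow> 'h \<Rightarrow> complex"
  assumes add: "\<And>f g. f \<in> D \<Longrightarrow> g \<in> D \<Longrightarrow> f + g \<in> D"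
    and scale: "\<And>f c. f \<in> D \<Longrightarrow> c *\<^sub>C f \<in> D"
    and B_add: "\<And>f g h. f \<in> D \<Longrightarrow> g \<in> D \<Longrightarrow> h \<in> D \<Longrightarrow> B (f + g) h = B f h + B g h"
      "\<And>f g h. f \<in> D \<Longrightarrow> g \<in> D \<Longrightarrow> h \<in> D \<Longrightarrow> B h (f + g) = B h f + B h g"
    and B_scale: "\<And>f g c. f \<in> D \<Longrightarrow> g \<in> D \<Longrightarrow> B (c *\<^sub>C f) g = c * B f g"
      "\<And>f g c. f \<in> D \<Longrightarrow> g \<in> D \<Longrightarrow> B f (c *\<^sub>C g) = cnj c * B f g"
    and diag: "\<And>f. f \<in> D \<Longrightarrow> B f f = 0"
    and "f \<in> D" "g \<in> D"
  shows "B f g = 0"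
proof -
  have anti: "B f h + B h f = 0" if "h \<in> D" for h
    using diag[of "f + h"] diag[of f] diag[of h] assms(8) that by (simp add: add B_add add.commute)
  have "B f g + B g f = 0" by (rule anti[OF assms(9)])
  moreover have "- (\<i> * B f g) + \<i> * B g f = 0"
    using anti[OF scale[OF assms(9), of \<i>]] assms(8,9) by (simp add: B_scale)
  then have "B g f = B f g" by simp
  ultimately show ?thesis by simp
qed

context formally_normal_family
begin

text \<open>
  \<open>A\<^sup>*(t) f\<close>, once \<open>f\<close> is known to lie in the domain of the adjoint.
\<close>

definition adj_act :: "real \<Rightarrow> 'h \<Rightarrow> 'h" where
  "adj_act t f = (SOME z. \<forall>g\<in>D. cinner (act t g) f = cinner g z)"

text \<open>
  For almost every time this is Cauchy-Schwarz for \<open>Y\<close> in \<open>adjoint_pointwise\<close>. Both sides are continuous in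
  \<open>t\<close> where \<open>\<alpha> > 0\<close>, because neither of them contains an adjoint, and a nonempty open set is not a null set.
\<close>

lemma adjoint_bound:
  assumes t: "t \<in> positive_times" and f: "f \<in> D" and g: "g \<in> D"
  shows "(cmod (cinner (act t g) f))\<^sup>2 \<le> (norm g)\<^sup>2 * adj_norm_sq t f"
proof -
  obtain G where G: "countable G" "G \<subseteq> D" "closure G = UNIV"
    using countable_uniform_core by metis
  have "closure (insert f (insert g G)) = UNIV"
    using closure_mono[of G "insert f (insert g G)"] G(3) by blast
  then obtain Y where Y: "AE s in M. (\<forall>g\<in>insert f (insert g G). cinner (act s g) f = cinner g (Y s)) \<and>
      (norm (Y s))\<^sup>2 = adj_norm_sq s f"
    using adjoint_pointwise[OF f, of "insert f (insert g G)"] G f g by auto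
  have ae: "AE s in M. (norm g)\<^sup>2 * adj_norm_sq s f - (cmod (cinner (act s g) f))\<^sup>2 \<in> {0..}"
    using Y
  proof eventually_elim
    case (elim s)
    have "cmod (cinner g (Y s)) \<le> norm g * norm (Y s)" by (rule cinner_Cauchy_Schwarz)
    then have "(cmod (cinner (act s g) f))\<^sup>2 \<le> (norm g * norm (Y s))\<^sup>2"
      using elim by (intro power_mono) auto
    then show ?case using elim by (simp add: power_mult_distrib)
  qed
  let ?h = "\<lambda>s. (norm g)\<^sup>2 * adj_norm_sq s f - (cmod (cinner (act s g) f))\<^sup>2"
  have cont: "continuous_on positive_times ?h"
    by (intro continuous_intros adj_norm_sq_cont f cinner.continuous_on
        continuous_on_subset[OF act_cont[OF g] positive_times_subset(2)])
  have "t \<in> positive_times \<and> ?h t \<in> {0..}"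
  proof (rule conjI[OF t], rule ccontr)
    assume "?h t \<notin> {0..}"
    then have neg: "?h t \<in> {..<0}" by simp
    have op: "open (positive_times \<inter> ?h -` {..<0})"
      by (rule continuous_open_preimage[OF cont open_positive_times]) simp
    have "AE s\<in>(positive_times \<inter> ?h -` {..<0}) in lebesgue. s \<in> {}"
    proof -
      have "AE s in lebesgue. s \<in> {0<..<1} \<longrightarrow> ?h s \<in> {0..}"
        using ae by (subst (asm) AE_restrict_space_iff) auto
      then show ?thesis by eventually_elim (use positive_times_subset(1) in auto)
    qed
    from mem_closed_if_AE_lebesgue_open[OF op closed_empty this, of t] show False
      using t neg by simp
  qed
  then show ?thesis by simp
qed

lemma adj_act_spec:
  assumes t: "t \<in> positive_times" and f: "f \<in> D"
  shows "\<And>g. g \<in> D \<Longrightarrow> cinner (act t g) f = cinner g (adj_act t f)"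
proof -
  have t01: "t \<in> {0..1}" using t positive_times_subset(2) by blast
  obtain z where "\<And>g. g \<in> D \<Longrightarrow> cinner (act t g) f = cinner g z"
  proof (rule Riesz_on_subspace[of D "\<lambda>g. cinner (act t g) f" "sqrt (max (adj_norm_sq t f) 0)"])
    fix g assume g: "g \<in> D"
    have "(cmod (cinner (act t g) f))\<^sup>2 \<le> (norm g)\<^sup>2 * adj_norm_sq t f" by (rule adjoint_bound[OF t f g])
    also have "\<dots> \<le> (norm g)\<^sup>2 * max (adj_norm_sq t f) 0" by (intro mult_left_mono) auto
    also have "\<dots> = (sqrt (max (adj_norm_sq t f) 0) * norm g)\<^sup>2" by (simp add: power_mult_distrib)
    finally show "cmod (cinner (act t g) f) \<le> sqrt (max (adj_norm_sq t f) 0) * norm g"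
      by (rule power2_le_imp_le) simp
  qed (simp_all add: D_zero D_add D_scale act_add[OF t01] act_scale[OF t01] cinner_add_left cinner_scaleC_left)
  then have "\<exists>z. \<forall>g\<in>D. cinner (act t g) f = cinner g z" by blast
  from someI_ex[OF this] have "\<forall>g\<in>D. cinner (act t g) f = cinner g (adj_act t f)"
    unfolding adj_act_def .
  then show "\<And>g. g \<in> D \<Longrightarrow> cinner (act t g) f = cinner g (adj_act t f)" by blast
qed

lemma adj_act_unique:
  assumes t: "t \<in> positive_times" and f: "f \<in> D" and G: "G \<subseteq> D" "closure G = UNIV"
    and z: "\<And>g. g \<in> G \<Longrightarrow> cinner (act t g) f = cinner g z"
  shows "z = adj_act t f"
proof (rule eq_if_cinner_eq_on_dense[OF G(2)])
  fix g assume "g \<in> G"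
  then have "cinner g z = cinner g (adj_act t f)" using z adj_act_spec[OF t f] G(1) by (metis subsetD)
  then show "cinner z g = cinner (adj_act t f) g" by (metis cinner_commute)
qed

lemma adj_iff:
  assumes t: "t \<in> positive_times" and f: "f \<in> D"
  shows "(f, z) \<in> adj (A t) \<longleftrightarrow> z = adj_act t f"
proof -
  have t01: "t \<in> {0..1}" using t positive_times_subset(2) by blast
  show ?thesis
  proof
    assume z: "(f, z) \<in> adj (A t)"
    show "z = adj_act t f"
    proof (rule adj_act_unique[OF t f order_refl D_dense])
      fix g assume "g \<in> D"
      then show "cinner (act t g) f = cinner g z"
        using z graph_act[OF t01] unfolding op_adjoint_def by blast
    qed
  next
    assume z: "z = adj_act t f"
    have "cinner y f = cinner u z" if "(u, y) \<in> A t" for u y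
    proof -
      have "u \<in> D" "y = act t u" using that graph_iff[OF t01] by blast+
      then show ?thesis using adj_act_spec[OF t f] z by blast
    qed
    then show "(f, z) \<in> adj (A t)" unfolding op_adjoint_def by blast
  qed
qed

text \<open>
  The absolute value saves the proof that \<open>adj_norm_sq t f\<close> is nonnegative. An inequality for all \<open>f \<in> D\<close>
  suffices to make \<open>A\<^sup>*(t)\<close> continuous along the sequences of \<open>countable_uniform_core\<close>.
\<close>

lemma adj_act_norm_le:
  assumes t: "t \<in> positive_times" and f: "f \<in> D"
  shows "(norm (adj_act t f))\<^sup>2 \<le> \<bar>adj_norm_sq t f\<bar>"
proof -
  have "norm (adj_act t f) \<le> sqrt \<bar>adj_norm_sq t f\<bar>"
  proof (rule norm_le_if_cinner_le_on_dense[OF D_dense])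
    fix g assume g: "g \<in> D"
    have "(cmod (cinner (act t g) f))\<^sup>2 \<le> (norm g)\<^sup>2 * adj_norm_sq t f" by (rule adjoint_bound[OF t f g])
    also have "\<dots> \<le> (norm g)\<^sup>2 * \<bar>adj_norm_sq t f\<bar>" by (intro mult_left_mono) auto
    also have "\<dots> = (sqrt \<bar>adj_norm_sq t f\<bar> * norm g)\<^sup>2" by (simp add: power_mult_distrib)
    finally have "cmod (cinner (act t g) f) \<le> sqrt \<bar>adj_norm_sq t f\<bar> * norm g"
      by (rule power2_le_imp_le) simp
    then show "cmod (cinner g (adj_act t f)) \<le> sqrt \<bar>adj_norm_sq t f\<bar> * norm g"
      using adj_act_spec[OF t f g] by simp
  qed simp
  then have "(norm (adj_act t f))\<^sup>2 \<le> (sqrt \<bar>adj_norm_sq t f\<bar>)\<^sup>2" by (rule power_mono) simp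
  then show ?thesis by simp
qed

lemma adj_act_add:
  assumes t: "t \<in> positive_times" and "f \<in> D" "h \<in> D"
  shows "adj_act t (f + h) = adj_act t f + adj_act t h"
proof (rule sym, rule adj_act_unique[OF t _ order_refl D_dense])
  show "cinner (act t g) (f + h) = cinner g (adj_act t f + adj_act t h)" if "g \<in> D" for g
    unfolding cinner_add_right adj_act_spec[OF t assms(2) that] adj_act_spec[OF t assms(3) that] ..
qed (use assms D_add in blast)

lemma adj_act_scale:
  assumes t: "t \<in> positive_times" and "f \<in> D"
  shows "adj_act t (z *\<^sub>C f) = z *\<^sub>C adj_act t f"
proof (rule sym, rule adj_act_unique[OF t _ order_refl D_dense])
  show "cinner (act t g) (z *\<^sub>C f) = cinner g (z *\<^sub>C adj_act t f)" if "g \<in> D" for g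
    unfolding cinner_scaleC_right adj_act_spec[OF t assms(2) that] ..
qed (use assms D_scale in blast)

lemma adj_act_diff:
  assumes t: "t \<in> positive_times" and "f \<in> D" "h \<in> D"
  shows "adj_act t (f - h) = adj_act t f - adj_act t h"
  using adj_act_add[OF t, of "f - h" h] assms by (simp add: D_diff)

text \<open>
  On the countable set \<open>G\<close> the identity holds outside one null set. If \<open>u n \<longlonglongrightarrow> f\<close> together with the images
  under \<open>A(t)\<close> and \<open>A'(t)\<close>, then \<open>adj_norm_sq t (u n - f)\<close> tends to zero; it dominates
  \<open>\<parallel>A\<^sup>*(t) (u n - f)\<parallel>\<^sup>2\<close>, and so both sides of the identity pass to the limit.
\<close>

lemma AE_norm_adj_act:
  "AE t in M. t \<in> positive_times \<and> (\<forall>f\<in>D. (norm (adj_act t f))\<^sup>2 = adj_norm_sq t f)"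
proof -
  obtain G where G: "countable G" "G \<subseteq> D" "closure G = UNIV"
    and core: "\<And>f. f \<in> D \<Longrightarrow> \<exists>u. (\<forall>n. u n \<in> G) \<and> u \<longlonglongrightarrow> f \<and>
       (\<forall>t\<in>{0..1}. (\<lambda>n. act t (u n)) \<longlonglongrightarrow> act t f \<and> (\<lambda>n. dact t (u n)) \<longlonglongrightarrow> dact t f)"
    using countable_uniform_core by blast
  have "AE t in M. \<forall>f\<in>G. (norm (adj_act t f))\<^sup>2 = adj_norm_sq t f"
  proof (rule AE_ball_countable'[OF _ G(1)])
    fix f assume f: "f \<in> G"
    then have fD: "f \<in> D" using G(2) by blast
    obtain Y where Y: "AE t in M. (\<forall>g\<in>G. cinner (act t g) f = cinner g (Y t)) \<and> (norm (Y t))\<^sup>2 = adj_norm_sq t f"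
      using adjoint_pointwise[OF fD G f] by blast
    then show "AE t in M. (norm (adj_act t f))\<^sup>2 = adj_norm_sq t f"
      using AE_positive_times
    proof eventually_elim
      case (elim t)
      have "Y t = adj_act t f" by (rule adj_act_unique[OF elim(2) fD G(2,3)]) (use elim(1) in blast)
      then show ?case using elim(1) by simp
    qed
  qed
  then show ?thesis using AE_positive_times
  proof eventually_elim
    case (elim t)
    have t01: "t \<in> {0..1}" "t \<in> {0<..<1}" using elim(2) positive_times_subset by blast+
    have "(norm (adj_act t f))\<^sup>2 = adj_norm_sq t f" if f: "f \<in> D" for f
    proof -
      obtain u where u: "\<And>n. u n \<in> G" "u \<longlonglongrightarrow> f" "(\<lambda>n. act t (u n)) \<longlonglongrightarrow> act t f" "(\<lambda>n. dact t (u n)) \<longlonglongrightarrow> dact t f"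
        using core[OF f] t01(1) by blast
      have uD: "u n \<in> D" for n using u(1) G(2) by blast
      have K_lim: "(\<lambda>n. adj_norm_sq t (u n)) \<longlonglongrightarrow> adj_norm_sq t f"
        by (rule adj_norm_sq_tendsto[OF elim(2) u(2-4)])
      have a0: "act t 0 = 0" "dact t 0 = 0"
        using act_diff[OF t01(1) f f] dact_diff[OF t01(2) f f] by simp_all
      have "(\<lambda>n. adj_norm_sq t (u n - f)) \<longlonglongrightarrow> adj_norm_sq t 0"
      proof (rule adj_norm_sq_tendsto[OF elim(2)])
        show "(\<lambda>n. u n - f) \<longlonglongrightarrow> 0" using u(2) by (rule LIM_zero)
        show "(\<lambda>n. act t (u n - f)) \<longlonglongrightarrow> act t 0"
          using LIM_zero[OF u(3)] by (simp add: a0 act_diff[OF t01(1) uD f])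
        show "(\<lambda>n. dact t (u n - f)) \<longlonglongrightarrow> dact t 0"
          using LIM_zero[OF u(4)] by (simp add: a0 dact_diff[OF t01(2) uD f])
      qed
      moreover have "adj_norm_sq t 0 = 0" by (simp add: adj_norm_sq_def shifted_form_deriv_def a0 cinner.zero_left)
      ultimately have "(\<lambda>n. \<bar>adj_norm_sq t (u n - f)\<bar>) \<longlonglongrightarrow> 0" using tendsto_rabs by fastforce
      then have "(\<lambda>n. (norm (adj_act t (u n) - adj_act t f))\<^sup>2) \<longlonglongrightarrow> 0"
      proof (rule tendsto_sandwich[rotated 3])
        show "\<forall>\<^sub>F n in sequentially. (norm (adj_act t (u n) - adj_act t f))\<^sup>2 \<le> \<bar>adj_norm_sq t (u n - f)\<bar>"
          using adj_act_norm_le[OF elim(2) D_diff[OF uD f]] by (simp add: adj_act_diff[OF elim(2) uD f])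
      qed auto
      then have "(\<lambda>n. sqrt ((norm (adj_act t (u n) - adj_act t f))\<^sup>2)) \<longlonglongrightarrow> sqrt 0" by (rule tendsto_real_sqrt)
      then have "(\<lambda>n. norm (adj_act t (u n) - adj_act t f)) \<longlonglongrightarrow> 0" by simp
      then have "(\<lambda>n. adj_act t (u n)) \<longlonglongrightarrow> adj_act t f"
        by (simp add: tendsto_norm_zero_iff LIM_zero_iff)
      then have "(\<lambda>n. (norm (adj_act t (u n)))\<^sup>2) \<longlonglongrightarrow> (norm (adj_act t f))\<^sup>2" by (intro tendsto_intros)
      moreover have "(norm (adj_act t (u n)))\<^sup>2 = adj_norm_sq t (u n)" for n using elim(1) u(1) by blast
      ultimately show ?thesis using K_lim LIMSEQ_unique by simp
    qed
    then show ?case using elim(2) by blast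
  qed
qed

lemma commutator_form:
  assumes t: "t \<in> positive_times" and norm_adj_act: "\<forall>f\<in>D. (norm (adj_act t f))\<^sup>2 = adj_norm_sq t f" and "f \<in> D" "e \<in> D"
  shows "cinner (act t f) (act t e) - cinner (adj_act t f) (adj_act t e) = shifted_form_deriv t f e"
proof -
  have t01: "t \<in> {0..1}" "t \<in> {0<..<1}" using t positive_times_subset by blast+
  define B where "B f e = cinner (act t f) (act t e) - cinner (adj_act t f) (adj_act t e) - shifted_form_deriv t f e" for f e
  have "B f e = 0"
  proof (rule sesquilinear_eq_zero[of D])
    fix f assume f: "f \<in> D"
    have "cinner f (dact t f) = cnj (cinner (dact t f) f)" by (rule cinner_commute)
    then have "Im (shifted_form_deriv t f f) = 0" by (simp add: shifted_form_deriv_def cinner_self)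
    then show "B f f = 0"
      using norm_adj_act f unfolding B_def cinner_self
      by (simp add: complex_eq_iff adj_norm_sq_def)
  qed (use assms t01 in \<open>simp_all add: B_def shifted_form_deriv_def D_add D_scale act_add act_scale adj_act_add adj_act_scale dact_add dact_scale
      cinner_add_left cinner_add_right cinner_scaleC_left cinner_scaleC_right algebra_simps
      scaleR_conv_of_real add_divide_distrib diff_divide_distrib\<close>)
  then show ?thesis by (simp add: B_def)
qed

lemma self_commutator_form:
  assumes t: "t \<in> positive_times" and norm_adj_act: "\<forall>f\<in>D. (norm (adj_act t f))\<^sup>2 = adj_norm_sq t f"
    and fg: "(f, g) \<in> self_commutator (A t)" and e: "e \<in> D"
  shows "f \<in> D \<and> cinner g e = shifted_form_deriv t f e"
proof -
  have t01: "t \<in> {0..1}" using t positive_times_subset by blast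
  obtain g1 g2 y z where g: "g = g1 - g2" and y: "(f, y) \<in> A t" "(y, g1) \<in> adj (A t)"
    and z: "(f, z) \<in> adj (A t)" "(z, g2) \<in> A t"
    using fg unfolding self_commutator_def op_diff_def op_mult_def by blast
  have f: "f \<in> D" and y_eq: "y = act t f" using y(1) graph_iff[OF t01] by auto
  have z_eq: "z = adj_act t f" using z(1) adj_iff[OF t f] by blast
  have zD: "z \<in> D" and g2: "g2 = act t z" using z(2) graph_iff[OF t01] by auto
  have "cinner (act t e) y = cinner e g1"
    using y(2) graph_act[OF t01 e] unfolding op_adjoint_def by blast
  then have "cinner g1 e = cinner (act t f) (act t e)" unfolding y_eq by (metis cinner_commute)
  moreover have "cinner g2 e = cinner (adj_act t f) (adj_act t e)"
    using adj_act_spec[OF t e zD] unfolding g2 z_eq .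
  ultimately show ?thesis
    using commutator_form[OF t norm_adj_act f e] f by (simp add: g cinner.diff_left)
qed

text \<open>
  The operator \<open>A + A\<^sup>*\<close> is symmetric on \<open>D\<close>: each pair \<open>(u, v)\<close> of its graph satisfies
  \<open>\<langle>v, e\<rangle> = \<langle>u, (A + A\<^sup>*) e\<rangle>\<close> for \<open>e \<in> D\<close>. This relation is stable under limits of pairs, so the closure
  satisfies it too, and its values at \<open>f\<close> are determined.
\<close>

lemma real_part_shifted_form:
  assumes t: "t \<in> positive_times" and y: "(f, y) \<in> real_part_shifted \<alpha> \<alpha>' A t" and f: "f \<in> D" and e: "e \<in> D"
  shows "cinner y e = shifted_form t f e"
proof -
  have t01: "t \<in> {0..1}" using t positive_times_subset by blast
  obtain v where v: "(f, v) \<in> op_closure UNIV cinner (op_add (A t) (adj (A t)))"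
    and y_eq: "y = 2 *\<^sub>C (1/2) *\<^sub>C v - complex_of_real (\<alpha>' t / \<alpha> t) *\<^sub>C f"
    using y unfolding real_part_shifted_def op_diff_def op_scale_def op_Re_def by auto
  have sym: "cinner v' e = cinner u (act t e + adj_act t e)" if uv: "(u, v') \<in> op_add (A t) (adj (A t))" for u v'
  proof -
    obtain g h where "v' = g + h" "(u, g) \<in> A t" "(u, h) \<in> adj (A t)"
      using uv unfolding op_add_def by blast
    moreover from this have u: "u \<in> D" "g = act t u" using graph_iff[OF t01] by auto
    moreover have "cinner (act t e) u = cinner e h"
      using \<open>(u, h) \<in> adj (A t)\<close> graph_act[OF t01 e] unfolding op_adjoint_def by blast
    then have "cinner h e = cinner u (act t e)" by (metis cinner_commute)
    ultimately show ?thesis using adj_act_spec[OF t e u(1)] by (simp add: cinner_add_left cinner_add_right)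
  qed
  define k where "k = act t e + adj_act t e"
  have small: "cmod (cinner v e - cinner f k) \<le> r * (norm e + norm k)" if r: "r > 0" for r
  proof -
    obtain u v' where uv: "(u, v') \<in> op_add (A t) (adj (A t))" and
      close: "norm (u - f) < r" "norm (v' - v) < r"
      using v r unfolding op_closure_def ip_norm_cinner by blast
    have "cinner v e - cinner f k = cinner (u - f) k - cinner (v' - v) e"
      using sym[OF uv] by (simp add: k_def cinner.diff_left)
    also have "cmod \<dots> \<le> norm (u - f) * norm k + norm (v' - v) * norm e"
      using norm_triangle_ineq4 cinner_Cauchy_Schwarz add_mono order_trans by meson
    also have "\<dots> \<le> r * norm k + r * norm e"
      using close by (intro add_mono mult_right_mono) auto
    finally show ?thesis by (simp add: algebra_simps)
  qed
  have "cmod (cinner v e - cinner f k) \<le> 0 + r" if r: "r > 0" for r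
  proof -
    define S where "S = norm e + norm k + 1"
    have S: "S > 0" unfolding S_def by (smt (verit) norm_ge_zero)
    have "cmod (cinner v e - cinner f k) \<le> (r / S) * (norm e + norm k)"
      using small[of "r / S"] r S by simp
    also have "\<dots> \<le> (r / S) * S" using r S by (intro mult_left_mono) (auto simp: S_def)
    finally show ?thesis using S by simp
  qed
  then have "cmod (cinner v e - cinner f k) \<le> 0" by (rule field_le_epsilon)
  then have "cinner v e = cinner (act t f) e + cinner f (act t e)"
    using adj_act_spec[OF t e f] by (simp add: k_def cinner_add_right)
  moreover have "2 *\<^sub>C (1/2) *\<^sub>C v = v" 
    using scaleC_of_real[of 1 v] by (simp add: scaleC_scaleC)
  ultimately show ?thesis
    by (simp add: y_eq shifted_form_def cinner.diff_left cinner_scaleC_left scaleR_conv_of_real)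
qed

lemma real_part_shifted_mem:
  assumes t: "t \<in> positive_times" and f: "f \<in> D"
  shows "\<exists>y. (f, y) \<in> real_part_shifted \<alpha> \<alpha>' A t"
proof -
  have t01: "t \<in> {0..1}" using t positive_times_subset by blast
  have "(f, act t f + adj_act t f) \<in> op_add (A t) (adj (A t))"
    unfolding op_add_def using graph_act[OF t01 f] adj_iff[OF t f] by blast
  moreover have "S \<subseteq> op_closure UNIV cinner S" for S :: "('h \<times> 'h) set"
    by (rule op_closure_superset) (simp_all add: cinner.zero_left)
  ultimately have "(f, act t f + adj_act t f) \<in> op_closure UNIV cinner (op_add (A t) (adj (A t)))" by blast
  then show ?thesis
    unfolding real_part_shifted_def op_diff_def op_scale_def op_Re_def by auto
qed

lemma commutator_is_derivative:
  "AE t in lebesgue_on {0<..<1}.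
      (\<forall>f g d. (f, g) \<in> self_commutator (A t) \<longrightarrow>
               (f, d) \<in> strong_derivative (real_part_shifted \<alpha> \<alpha>' A) t \<longrightarrow> g = d) \<and>
      self_commutator (A t) \<subseteq> weak_derivative D (real_part_shifted \<alpha> \<alpha>' A) t"
  using AE_norm_adj_act
proof eventually_elim
  case (elim t)
  then have t: "t \<in> positive_times" and norm_adj_act: "\<forall>f\<in>D. (norm (adj_act t f))\<^sup>2 = adj_norm_sq t f" by auto
  have near: "\<forall>\<^sub>F s in nhds t. s \<in> positive_times"
    using open_positive_times t by (rule eventually_nhds_in_open)
  have weak: "((\<lambda>s. cinner (x s) e) has_vector_derivative cinner g e) (at t)"
    if fg: "(f, g) \<in> self_commutator (A t)" and e: "e \<in> D"
      and x: "\<forall>\<^sub>F s in nhds t. (f, x s) \<in> real_part_shifted \<alpha> \<alpha>' A s" for f g e x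
  proof -
    have f: "f \<in> D" and ge: "cinner g e = shifted_form_deriv t f e" using self_commutator_form[OF t norm_adj_act fg e] by auto
    have "\<forall>\<^sub>F s in nhds t. cinner (x s) e = shifted_form s f e"
      using near x by eventually_elim (rule real_part_shifted_form[OF _ _ f e])
    then have "((\<lambda>s. cinner (x s) e) has_vector_derivative cinner g e) (at t)
        \<longleftrightarrow> ((\<lambda>s. shifted_form s f e) has_vector_derivative cinner g e) (at t)"
      by (intro has_vector_derivative_cong_ev) (auto elim: eventually_mono dest: eventually_nhds_x_imp_x)
    then show ?thesis using shifted_form_has_derivative[OF t f e] ge by simp
  qed
  show ?case
  proof (intro conjI allI impI subsetI)
    fix f g d
    assume fg: "(f, g) \<in> self_commutator (A t)"
      and "(f, d) \<in> strong_derivative (real_part_shifted \<alpha> \<alpha>' A) t"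
    then obtain x where x: "\<forall>\<^sub>F s in nhds t. (f, x s) \<in> real_part_shifted \<alpha> \<alpha>' A s"
      and d: "(x has_vector_derivative d) (at t)"
      unfolding strong_derivative_def by blast
    show "g = d"
    proof (rule eq_if_cinner_eq_on_dense[OF D_dense])
      fix e assume e: "e \<in> D"
      have "((\<lambda>s. cinner (x s) e) has_vector_derivative cinner d e) (at t)"
        by (rule bounded_linear.has_vector_derivative[OF cinner.bounded_linear_left d])
      with weak[OF fg e x] show "cinner g e = cinner d e" by (rule vector_derivative_unique_at)
    qed
  next
    fix p assume p: "p \<in> self_commutator (A t)"
    obtain f g where fg: "p = (f, g)" by (cases p)
    have f: "f \<in> D" using self_commutator_form[OF t norm_adj_act _ D_zero] p fg by blast
    obtain x where x: "\<And>s. s \<in> positive_times \<Longrightarrow> (f, x s) \<in> real_part_shifted \<alpha> \<alpha>' A s"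
      using real_part_shifted_mem[OF _ f] by metis
    have "\<forall>\<^sub>F s in nhds t. (f, x s) \<in> real_part_shifted \<alpha> \<alpha>' A s"
      using near by eventually_elim (rule x)
    then show "p \<in> weak_derivative D (real_part_shifted \<alpha> \<alpha>' A) t"
      using weak p unfolding weak_derivative_def fg by blast
  qed
qed

end

theorem theorem1:
  fixes A :: "real \<Rightarrow> ('h::{chilbert_space,second_countable_topology} \<times> 'h) set"
    and D :: "'h set"
    and \<alpha> \<alpha>' \<alpha>'' :: "real \<Rightarrow> real"
  assumes "\<forall>t\<in>{0..1}. 0 \<le> \<alpha> t"
    and "\<forall>t\<in>{0..1}. (\<alpha> has_real_derivative \<alpha>' t) (at t within {0..1})"
    and "\<forall>t\<in>{0..1}. (\<alpha>' has_real_derivative \<alpha>'' t) (at t within {0..1})"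
    and "continuous_on {0..1} \<alpha>''"
    and "{t\<in>{0..1}. \<alpha> t = 0} \<in> null_sets lebesgue"
    and "\<forall>t\<in>{0..1}. closed_operator UNIV cinner (A t) \<and> densely_defined UNIV cinner (A t)"
    and "\<forall>t\<in>{0..1}. Domain (A t) = D"
    and "\<forall>f\<in>D. \<exists>x x'. (\<forall>t\<in>{0..1}. (f, x t) \<in> A t \<and>
                                   (x has_vector_derivative x' t) (at t within {0..1})) \<and>
                     continuous_on {0..1} x'"
    and "AE t in lebesgue_on {0<..<1}. op_bounded_below (op_Re (A t)) (\<alpha>' t / (2 * \<alpha> t))"
    and "formally_normal (L2w \<alpha>) (L2w_inner \<alpha>) (minimal_operator \<alpha> D A)"
  shows "AE t in lebesgue_on {0<..<1}.
      (\<forall>f g d. (f, g) \<in> self_commutator (A t) \<longrightarrow>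
               (f, d) \<in> strong_derivative (real_part_shifted \<alpha> \<alpha>' A) t \<longrightarrow> g = d) \<and>
      self_commutator (A t) \<subseteq> weak_derivative D (real_part_shifted \<alpha> \<alpha>' A) t"
proof -
  interpret formally_normal_family A D \<alpha> \<alpha>' \<alpha>''
    by unfold_locales (fact assms)+
  show ?thesis by (rule commutator_is_derivative)
qed

end
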